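(* Let $m,n$ be positive integers with $n\ge m-1$. Then the $h^*$-polynomial of the partial permutohedron $\mathcal{P}(m,n)$ is real-rooted.
   Context: For positive integers $m,n$, the partial permutohedron $\mathcal{P}(m,n)\subset\mathbb{R}^m$ is the convex hull of all vectors in $\{0,1,\ldots,n\}^m$ whose nonzero entries are pairwise distinct. It is an $m$-dimensional lattice polytope. For a lattice polytope $\mathcal{P}\subset\mathbb{R}^N$ of dimension $d$, the Ehrhart polynomial $i(\mathcal{P},t)$ is the polynomial in $t$ satisfying $i(\mathcal{P},t)=|t\mathcal{P}\cap\mathbb{Z}^N|$ for all positive integers $t$. The $h^*$-polynomial $h^*_{\mathcal{P}}(x)$ is the polynomial of degree at most $d$ defined by $$1+\sum_{t\ge 1} i(\mathcal{P},t)x^t=\frac{h^*_{\mathcal{P}}(x)}{(1-x)^{d+1}}.$$ A polynomial with real coefficients is real-rooted if all its complex roots are real; nonzero constant polynomials are regarded as real-rooted. *)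

theory Defs
  imports "HOL-Analysis.Analysis" "HOL-Computational_Algebra.Computational_Algebra"
begin

text \<open>The dimension \<open>m\<close> of the ambient space is the cardinality of the index type \<open>'m\<close>.\<close>

definition partial_permutohedron :: "nat \<Rightarrow> (real ^ 'm) set" where
  "partial_permutohedron n = convex hull
     {v. (\<forall>i. \<exists>k\<le>n. v $ i = real k) \<and>
         (\<forall>i j. i \<noteq> j \<and> v $ i \<noteq> 0 \<and> v $ j \<noteq> 0 \<longrightarrow> v $ i \<noteq> v $ j)}"

definition lattice_point_count :: "(real ^ 'm) set \<Rightarrow> nat \<Rightarrow> nat" where
  "lattice_point_count P t =
     card ((\<lambda>x. real t *\<^sub>R x) ` P \<inter> {x. \<forall>i. x $ i \<in> \<int>})"

text \<open>The next two definitions are meaningful when \<open>P\<close> is a nonempty lattice polytope;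
  by Ehrhart's theorem the described polynomials then exist, and they are unique.
  \<open>aff_dim\<close> is the affine dimension, which is \<open>int\<close>-valued in the library.\<close>

definition ehrhart_poly :: "(real ^ 'm) set \<Rightarrow> real poly" where
  "ehrhart_poly P =
     (THE p. \<forall>t>0. poly p (real t) = real (lattice_point_count P t))"

definition h_star_poly :: "(real ^ 'm) set \<Rightarrow> real poly" where
  "h_star_poly P =
     (let d = nat (aff_dim P) in
      THE h. degree h \<le> d \<and>
        1 + Abs_fps (\<lambda>t. if t = 0 then 0 else poly (ehrhart_poly P) (real t))
          = fps_of_poly h / (1 - fps_X) ^ (d + 1))"

text \<open>Nonzero constants are real-rooted; the zero polynomial is not.\<close>

definition real_rooted :: "real poly \<Rightarrow> bool" where
  "real_rooted p \<longleftrightarrow> (\<forall>z :: complex. poly (map_poly complex_of_real p) z = 0 \<longrightarrow> z \<in> \<real>)"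

end

theory Submission imports Defs begin

text \<open>
  For \<open>n \<ge> m - 1\<close> the polytope is the set of all \<open>y \<ge> 0\<close> such that every \<open>k\<close> coordinates sum to at most
  \<open>n + (n - 1) + \<dots> + (n - k + 1)\<close>. The proof counts the lattice points of its dilates exactly,
  writes the resulting Ehrhart polynomial as
  \<open>\<Sum>\<^sub>j c\<^sub>j t\<^sup>j (1 + t)\<^bsup>m-j\<^esup>\<close>, and shows that the \<open>c\<^sub>j\<close> are nonnegative, with a single exception that is
  treated by hand.

  \<^bold>\<open>Nonnegative coefficients suffice.\<close> The numerators of the series
  \<open>\<Sum>\<^sub>t t\<^sup>j (1 + t)\<^bsup>d-j\<^esup> x\<^sup>t\<close> with respect to \<open>(1 - x)\<^bsup>d+1\<^esup>\<close> satisfy a recursion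
  in \<open>d\<close> whose steps are sums with nonnegative weights \<open>1\<close> and \<open>x\<close>. Evaluate all of them at one point \<open>z\<close> of the upper
  half-plane: the recursion keeps the values ordered by argument inside a sector of opening \<open>arg z < \<pi>\<close>,
  so no nontrivial nonnegative combination of them vanishes at \<open>z\<close>
  (\<open>in_sector_order_step\<close>, \<open>real_rooted_eulerian_combination\<close>).

  \<^bold>\<open>Counting.\<close> Adding a coordinate to a vector leaves it an interval of values whose
  length is governed by the \<open>excess\<close>, the largest violation among shifted subset inequalities. Summed over all
  lattice points, the excess is an explicit quadratic function of the shift: raising the shift at one place
  changes it by quantities of the same kind in one dimension less (\<open>total_excess_increment\<close>). The
  outcome is a linear recursion in \<open>m\<close>, solved by
  \<open>m! t\<^sup>m [x\<^sup>m] exp (r (x - x\<^sup>2/4)) e\<^bsup>nx\<^esup> (1 - x) K(x)\<close> with \<open>r = (1 + t)/t\<close> and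
  \<open>K(x) = (1 - x)\<^bsup>-1/2\<^esup> e\<^bsup>-x/2 + x\<^sup>2/4\<^esup>\<close>
  (\<open>card_bounded_vectors_eq_coeff\<close>). Expanding in powers of \<open>r\<close> gives the \<open>c\<^sub>j\<close>.

  \<^bold>\<open>Positivity.\<close> Let \<open>T = y e\<^sup>T\<close> be the series of rooted labelled trees. Lagrange inversion turns the
  \<open>x\<close>-coefficients into the \<open>y\<close>-coefficients of \<open>(T - T\<^sup>2/4)\<^sup>i e\<^bsup>(n-m)T\<^esup> K(T)\<close>. Here
  \<open>T - T\<^sup>2/4\<close> is nonnegative because \<open>T - T\<^sup>2/2\<close> counts unrooted trees, and \<open>K\<close> is the exponential of a
  nonnegative series; this settles \<open>n \<ge> m\<close>. For \<open>n = m - 1\<close> the last two factors together are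
  \<open>1 - y\<close> plus nonnegative terms (\<open>boundary_fps_nonneg\<close>), and multiplication by \<open>1 - y\<close> is harmless for
  \<open>i \<ge> 2\<close> and harms only one coefficient for \<open>i = 1\<close>. That coefficient is \<open>m = 2\<close>, \<open>n = 1\<close>: the unit triangle,
  whose \<open>h\<^sup>*\<close>-polynomial is \<open>1\<close>.
\<close>

section \<open>Refined Eulerian polynomials and real-rootedness\<close>

no_notation vec_nth (infixl "$" 90)

text \<open>The numerator of \<open>\<Sum>\<^sub>t t\<^sup>k (1 + t)\<^bsup>d-k\<^esup> x\<^sup>t\<close> over \<open>(1 - x)\<^bsup>d+1\<^esup>\<close>; it
  enumerates permutations of \<open>d + 1\<close> letters with prescribed first letter by descents. The recursion, rather than
  the series, is what propagates the location of zeros.\<close>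

primrec eulerian_refinement :: "nat \<Rightarrow> nat \<Rightarrow> real poly" where
  "eulerian_refinement 0 = (\<lambda>k. 1)"
| "eulerian_refinement (Suc d) = (\<lambda>k.
     [:0, 1:] * (\<Sum>j<k. eulerian_refinement d j) + (\<Sum>j=k..d. eulerian_refinement d j))"

text \<open>For \<open>Im z > 0\<close> this says that \<open>a 0, \<dots>, a d\<close> have increasing arguments, and that all of them lie between
  \<open>arg (a 0)\<close> and \<open>arg (a 0) + arg z\<close>. Signs of imaginary parts replace arguments, so that the
  conditions are bilinear and can be checked on sums term by term.\<close>

definition in_sector_order :: "complex \<Rightarrow> nat \<Rightarrow> (nat \<Rightarrow> complex) \<Rightarrow> bool" where
  "in_sector_order z d a \<longleftrightarrow>
     (\<forall>i\<le>d. a i \<noteq> 0) \<and>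
     (\<forall>i j. i < j \<and> j \<le> d \<longrightarrow> Im (cnj (a i) * a j) > 0) \<and>
     (\<forall>i j. i \<le> j \<and> j \<le> d \<longrightarrow> Im (cnj (a j) * (z * a i)) \<ge> 0)"

text \<open>Seen from the first term with positive weight, all later terms lie strictly on one side, so nothing
  can cancel.\<close>

lemma in_sector_order_combination_nonzero:
  fixes c :: "nat \<Rightarrow> real"
  assumes a: "in_sector_order z d a"
    and c: "\<And>j. j \<in> J \<Longrightarrow> c j \<ge> 0" "J \<subseteq> {..d}" "\<exists>j\<in>J. c j > 0"
  shows "(\<Sum>j\<in>J. complex_of_real (c j) * a j) \<noteq> 0"
proof
  assume zero: "(\<Sum>j\<in>J. complex_of_real (c j) * a j) = 0"
  have fin: "finite J" using c(2) finite_subset by blast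
  \<comment> \<open>the first index that carries weight\<close>
  define i where "i = (LEAST j. j \<in> J \<and> c j > 0)"
  have i: "i \<in> J" "c i > 0"
    using LeastI_ex[of "\<lambda>j. j \<in> J \<and> c j > 0"] c(3) unfolding i_def by auto
  have low: "c j = 0" if "j \<in> J" "j < i" for j
    using not_less_Least[of j "\<lambda>j. j \<in> J \<and> c j > 0"] that c(1)[OF that(1)] unfolding i_def by force
  have summand: "Im (cnj (a i) * (complex_of_real (c j) * a j)) = c j * Im (cnj (a i) * a j)" for j
    by (simp add: algebra_simps)
  have nn: "c j * Im (cnj (a i) * a j) \<ge> 0" if "j \<in> J" for j
  proof (cases j i rule: linorder_cases)
    case less
    then show ?thesis using low that by simp
  next
    case equal
    then show ?thesis by simp
  next
    case greater
    then show ?thesis using a c that unfolding in_sector_order_def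
      by (metis atMost_iff less_imp_le mult_nonneg_nonneg subset_eq)
  qed
  have "(\<Sum>j\<in>J. c j * Im (cnj (a i) * a j)) = Im (cnj (a i) * (\<Sum>j\<in>J. complex_of_real (c j) * a j))"
    by (simp only: sum_distrib_left Im_sum summand)
  hence "(\<Sum>j\<in>J. c j * Im (cnj (a i) * a j)) = 0" using zero by simp
  hence all0: "c j * Im (cnj (a i) * a j) = 0" if "j \<in> J" for j
    using sum_nonneg_eq_0_iff[OF fin nn] that by auto
  have "c j = 0" if "j \<in> J" "j \<noteq> i" for j
  proof (cases "j < i")
    case True
    then show ?thesis using low that by blast
  next
    case False
    hence "Im (cnj (a i) * a j) > 0" using a that c(2) unfolding in_sector_order_def by auto
    thus ?thesis using all0[OF that(1)] by auto
  qed
  hence "(\<Sum>j\<in>J. complex_of_real (c j) * a j) = complex_of_real (c i) * a i"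
    using sum.remove[OF fin i(1), of "\<lambda>j. complex_of_real (c j) * a j"] by simp
  moreover have "a i \<noteq> 0" using a i c(2) unfolding in_sector_order_def by auto
  ultimately show False using zero i by simp
qed

text \<open>With \<open>A\<close>, \<open>B\<close>, \<open>C\<close> the sums over \<open>j < k\<close>, \<open>k \<le> j < l\<close> and \<open>l \<le> j\<close>, the new values at \<open>k\<close>
  and \<open>l\<close> are \<open>zA + B + C\<close> and \<open>zA + zB + C\<close>. Expanding the imaginary part bilinearly, the mixed terms of \<open>zA\<close> and
  \<open>C\<close> cancel or combine to a square, and every other term has a sign by hypothesis. The term
  \<open>Im z |B|\<^sup>2\<close> makes the inequality strict.\<close>

lemma in_sector_order_step:
  assumes a: "in_sector_order z d a" and z: "Im z > 0"
  shows "in_sector_order z (Suc d) (\<lambda>k. z * (\<Sum>j<k. a j) + (\<Sum>j=k..d. a j))"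
proof -
  define b where "b = (\<lambda>k. z * (\<Sum>j<k. a j) + (\<Sum>j=k..d. a j))"
  have less: "Im (cnj (a i) * a j) > 0" if "i < j" "j \<le> d" for i j
    using a that unfolding in_sector_order_def by blast
  have wrap: "Im (cnj (a j) * (z * a i)) \<ge> 0" if "i \<le> j" "j \<le> d" for i j
    using a that unfolding in_sector_order_def by blast
  have ord: "Im (cnj (sum a I) * sum a J) \<ge> 0"
    if IJ: "\<And>i j. i \<in> I \<Longrightarrow> j \<in> J \<Longrightarrow> i < j \<and> j \<le> d" for I J
    unfolding cnj_sum sum_product Im_sum
    by (intro sum_nonneg less_imp_le[OF less]) (use IJ in blast)+
  have rot: "Im (cnj (sum a J) * (z * sum a I)) \<ge> 0"
    if IJ: "\<And>i j. i \<in> I \<Longrightarrow> j \<in> J \<Longrightarrow> i \<le> j \<and> j \<le> d" for I J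
    unfolding sum_distrib_left[of z] cnj_sum sum_product Im_sum
    by (intro sum_nonneg wrap) (use IJ in blast)+
  have self: "Im (cnj w * (z * w)) = Im z * (cmod w)\<^sup>2" for w
    unfolding cmod_power2 by (simp add: algebra_simps power2_eq_square)
  have zz: "Im (cnj (z * v) * (z * w)) = (cmod z)\<^sup>2 * Im (cnj v * w)" for v w
    unfolding cmod_power2 by (simp add: algebra_simps power2_eq_square)
  have pair: "Im (cnj (b k) * b l) > 0 \<and> Im (cnj (b l) * (z * b k)) \<ge> 0"
    if kl: "k < l" "l \<le> Suc d" for k l
  proof -
    define A where "A = sum a {..<k}"
    define B where "B = sum a {k..<l}"
    define C where "C = sum a {l..d}"
    have "sum a {..<l} = A + B"
      unfolding A_def B_def using kl(1)
      by (metis add.commute atLeast0LessThan less_imp_le_nat sum.atLeastLessThan_concat zero_le add.commute)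
    hence bl: "b l = z * (A + B) + C" unfolding b_def C_def by simp
    have "{k..d} = {k..<l} \<union> {l..d}" "{k..<l} \<inter> {l..d} = {}" using kl by auto
    hence "sum a {k..d} = B + C" unfolding B_def C_def by (simp add: sum.union_disjoint)
    hence bk: "b k = z * A + (B + C)" unfolding b_def A_def by simp
    have "(\<Sum>j\<in>{k..<l}. complex_of_real 1 * a j) \<noteq> 0"
      by (rule in_sector_order_combination_nonzero[OF a]) (use kl in auto)
    hence B0: "B \<noteq> 0" unfolding B_def by simp
    have AB: "Im (cnj A * B) \<ge> 0"
      unfolding A_def B_def by (rule ord) (use kl in auto)
    have BC: "Im (cnj B * C) \<ge> 0"
      unfolding B_def C_def by (rule ord) (use kl in auto)
    have BA: "Im (cnj B * (z * A)) \<ge> 0"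
      unfolding A_def B_def by (rule rot) (use kl in auto)
    have CB: "Im (cnj C * (z * B)) \<ge> 0"
      unfolding B_def C_def by (rule rot) (use kl in auto)
    have "Im (cnj (b k) * b l) = (cmod z)\<^sup>2 * Im (cnj A * B) + Im (cnj B * (z * A))
        + Im z * (cmod B)\<^sup>2 + Im (cnj B * C) + Im (cnj C * (z * B))"
      unfolding bk bl zz[symmetric] self[symmetric] by (simp add: algebra_simps)
    moreover have "Im z * (cmod B)\<^sup>2 > 0" using z B0 by simp
    ultimately have 1: "Im (cnj (b k) * b l) > 0" using AB BC BA CB by (smt (verit) mult_nonneg_nonneg zero_le_power2)
    have "Im (cnj (b l) * (z * b k)) = Im z * (cmod (z * A + C))\<^sup>2 + (cmod z)\<^sup>2 * Im (cnj A * B)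
        + (cmod z)\<^sup>2 * Im (cnj B * (z * A)) + (cmod z)\<^sup>2 * Im (cnj B * C) + Im (cnj C * (z * B))"
      unfolding bk bl zz[symmetric] self[symmetric] by (simp add: algebra_simps)
    hence 2: "Im (cnj (b l) * (z * b k)) \<ge> 0" using AB BC BA CB z by simp
    from 1 2 show ?thesis by blast
  qed
  have nz: "b i \<noteq> 0" if "i \<le> Suc d" for i
  proof (cases "i = Suc d")
    case True
    then show ?thesis using pair[of 0 "Suc d"] by auto
  next
    case False
    then show ?thesis using pair[of i "Suc d"] that by auto
  qed
  have "Im (cnj (b j) * (z * b i)) \<ge> 0" if "i \<le> j" "j \<le> Suc d" for i j
    using pair[of i j] that self[of "b i"] z by (cases "i = j") auto
  thus ?thesis using pair nz unfolding in_sector_order_def b_def[symmetric] by blast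
qed

lemma map_poly_of_real_add:
  "map_poly complex_of_real (p + q) = map_poly complex_of_real p + map_poly complex_of_real q"
  by (rule poly_eqI) (simp add: coeff_map_poly)

lemma map_poly_of_real_sum:
  "map_poly complex_of_real (sum f A) = (\<Sum>x\<in>A. map_poly complex_of_real (f x))"
  by (induction A rule: infinite_finite_induct) (simp_all add: map_poly_of_real_add)

lemma map_poly_of_real_smult:
  "map_poly complex_of_real (smult c p) = smult (complex_of_real c) (map_poly complex_of_real p)"
  by (rule poly_eqI) (simp add: coeff_map_poly)

lemma map_poly_of_real_times_X:
  "map_poly complex_of_real (pCons 0 p) = pCons 0 (map_poly complex_of_real p)"
  by (simp add: map_poly_pCons)

lemma eulerian_refinement_in_sector_order:
  assumes "Im z > 0"
  shows "in_sector_order z d (\<lambda>k. poly (map_poly complex_of_real (eulerian_refinement d k)) z)"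
proof (induction d)
  case 0
  then show ?case using assms by (simp add: in_sector_order_def)
next
  case (Suc d)
  have "poly (map_poly complex_of_real (eulerian_refinement (Suc d) k)) z
      = z * (\<Sum>j<k. poly (map_poly complex_of_real (eulerian_refinement d j)) z)
        + (\<Sum>j=k..d. poly (map_poly complex_of_real (eulerian_refinement d j)) z)" for k
    by (simp add: map_poly_of_real_add map_poly_of_real_times_X map_poly_of_real_sum poly_sum)
  thus ?case using in_sector_order_step[OF Suc assms] by simp
qed

text \<open>Zeros in the upper half-plane are excluded by the sector argument, those in the lower one by
  conjugation.\<close>

theorem real_rooted_eulerian_combination:
  fixes c :: "nat \<Rightarrow> real"
  assumes c: "\<And>j. j \<le> d \<Longrightarrow> c j \<ge> 0" "\<exists>j\<le>d. c j > 0"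
  shows "real_rooted (\<Sum>j\<le>d. smult (c j) (eulerian_refinement d j))"
  unfolding real_rooted_def
proof (intro allI impI)
  let ?p = "map_poly complex_of_real (\<Sum>j\<le>d. smult (c j) (eulerian_refinement d j))"
  have upper: "poly ?p z \<noteq> 0" if "Im z > 0" for z
  proof -
    have "poly ?p z = (\<Sum>j\<le>d. complex_of_real (c j)
        * poly (map_poly complex_of_real (eulerian_refinement d j)) z)"
      by (simp add: map_poly_of_real_sum map_poly_of_real_smult poly_sum)
    thus ?thesis
      using in_sector_order_combination_nonzero[OF eulerian_refinement_in_sector_order[OF that], of "{..d}" c d] c
      by auto
  qed
  fix z assume z: "poly ?p z = 0"
  have "poly ?p (cnj z) = 0"
    using real_poly_cnj_root_iff[of ?p z] z by (simp add: coeff_map_poly)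
  hence "\<not> Im z > 0" "\<not> Im z < 0" using upper[of z] upper[of "cnj z"] z by auto
  thus "z \<in> \<real>" by (simp add: complex_is_Real_iff)
qed

text \<open>Multiplying by \<open>1 - x\<close> takes differences \<open>p t - p (t - 1)\<close> of coefficients. For
  \<open>p t = t\<^sup>k (1 + t)\<^bsup>d+1-k\<^esup>\<close> the difference splits at \<open>t\<^bsup>d+1\<^esup>\<close> into two telescoping sums,
  one in \<open>t\<close> and one in \<open>t - 1\<close>; the latter is the part that the recursion multiplies by \<open>x\<close>.\<close>

lemma eulerian_refinement_series:
  assumes "k \<le> d"
  shows "fps_of_poly (eulerian_refinement d k)
    = (1 - fps_X) ^ Suc d * Abs_fps (\<lambda>t. real t ^ k * (1 + real t) ^ (d - k))"
  using assms
proof (induction d arbitrary: k)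
  case 0
  have "(1 - fps_X) * Abs_fps (\<lambda>t. 1::real) = 1"
    by (rule fps_ext) (simp add: left_diff_distrib split: nat.splits)
  then show ?case using 0 by simp
next
  case (Suc d)
  define G where "G = (\<lambda>d k. Abs_fps (\<lambda>t. real t ^ k * (1 + real t) ^ (d - k)))"
  have key: "(1 - fps_X) * G (Suc d) k = fps_X * (\<Sum>j<k. G d j) + (\<Sum>j=k..d. G d j)"
  proof (rule fps_ext)
    fix t
    have up: "(\<Sum>j=k..d. x ^ j * (1 + x) ^ (d - j)) = x ^ k * (1 + x) ^ (Suc d - k) - x ^ Suc d"
      if "k \<le> Suc d" for x :: real and k using that
    proof (induction k rule: inc_induct)
      case base
      then show ?case by simp
    next
      case (step k)
      have "(\<Sum>j=k..d. x ^ j * (1 + x) ^ (d - j)) = x ^ k * (1 + x) ^ (d - k) + (\<Sum>j=Suc k..d. x ^ j * (1 + x) ^ (d - j))"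
        using step by (intro sum.atLeast_Suc_atMost) simp
      also have "\<dots> = x ^ k * (1 + x) ^ (d - k) + (x ^ Suc k * (1 + x) ^ (d - k) - x ^ Suc d)"
        using step by simp
      also have "\<dots> = x ^ k * (1 + x) ^ (Suc d - k) - x ^ Suc d"
        using step by (simp add: Suc_diff_le algebra_simps)
      finally show ?case .
    qed
    have down: "(\<Sum>j<k. x ^ j * (1 + x) ^ (d - j)) = (1 + x) ^ Suc d - x ^ k * (1 + x) ^ (Suc d - k)"
      if "k \<le> Suc d" for x :: real and k using that
    proof (induction k)
      case (Suc k)
      then show ?case by (simp add: Suc_diff_le algebra_simps)
    qed simp
    show "((1 - fps_X) * G (Suc d) k) $ t = (fps_X * (\<Sum>j<k. G d j) + (\<Sum>j=k..d. G d j)) $ t"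
    proof (cases t)
      case 0
      then show ?thesis using up[OF Suc.prems, of 0] by (simp add: G_def fps_sum_nth left_diff_distrib)
    next
      case (Suc s)
      then show ?thesis
        using up[OF Suc.prems, of "real t"] down[OF Suc.prems, of "real s"]
        by (simp add: G_def fps_sum_nth left_diff_distrib add.commute)
    qed
  qed
  have "fps_of_poly (eulerian_refinement (Suc d) k)
      = fps_X * (\<Sum>j<k. fps_of_poly (eulerian_refinement d j)) + (\<Sum>j=k..d. fps_of_poly (eulerian_refinement d j))"
    by (simp add: fps_of_poly_add fps_of_poly_mult fps_of_poly_sum fps_of_poly_pCons)
  also have "\<dots> = fps_X * (\<Sum>j<k. (1 - fps_X) ^ Suc d * G d j) + (\<Sum>j=k..d. (1 - fps_X) ^ Suc d * G d j)"
    using Suc.IH Suc.prems unfolding G_def by simp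
  also have "\<dots> = (1 - fps_X) ^ Suc d * (fps_X * (\<Sum>j<k. G d j) + (\<Sum>j=k..d. G d j))"
    by (simp only: sum_distrib_left[symmetric] distrib_left mult.left_commute)
  also have "\<dots> = (1 - fps_X) ^ Suc (Suc d) * G (Suc d) k"
    unfolding key[symmetric] by (simp only: power_Suc2 mult.assoc)
  finally show ?case unfolding G_def .
qed

lemma degree_eulerian_refinement: "degree (eulerian_refinement d k) \<le> d"
proof (induction d arbitrary: k)
  case (Suc d)
  have "degree (\<Sum>j<k. eulerian_refinement d j) \<le> d" "degree (\<Sum>j=k..d. eulerian_refinement d j) \<le> d"
    using Suc by (auto intro!: degree_sum_le)
  hence "degree ([:0, 1:] * (\<Sum>j<k. eulerian_refinement d j)) \<le> Suc d"
      "degree (\<Sum>j=k..d. eulerian_refinement d j) \<le> Suc d"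
    using degree_mult_le[of "[:0, 1:]" "\<Sum>j<k. eulerian_refinement d j"] by auto
  thus ?case unfolding eulerian_refinement.simps by (rule degree_add_le)
qed simp

lemma ehrhart_poly_eqI:
  assumes "\<And>t. t > 0 \<Longrightarrow> poly p (real t) = real (lattice_point_count P t)"
  shows "ehrhart_poly P = p"
  unfolding ehrhart_poly_def
proof (rule the_equality)
  show "\<forall>t>0. poly p (real t) = real (lattice_point_count P t)" using assms by blast
  fix q assume q: "\<forall>t>0. poly q (real t) = real (lattice_point_count P t)"
  show "q = p"
  proof (rule ccontr)
    assume "q \<noteq> p"
    hence "finite {x. poly (q - p) x = 0}" by (intro poly_roots_finite) simp
    moreover have "real ` {0<..} \<subseteq> {x. poly (q - p) x = 0}" using q assms by auto
    ultimately have "finite (real ` {0<..})" by (rule finite_subset[rotated])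
    hence "finite {0::nat<..}" by (simp add: finite_image_iff inj_on_def)
    thus False by (simp add: infinite_Ioi)
  qed
qed

lemma h_star_poly_eqI:
  fixes P :: "(real ^ 'm) set"
  assumes d: "aff_dim P = int d" and p: "\<And>t. t > 0 \<Longrightarrow> poly p (real t) = real (lattice_point_count P t)"
    and p0: "poly p 0 = 1" and h: "degree h \<le> d"
    and series: "fps_of_poly h = (1 - fps_X) ^ Suc d * Abs_fps (\<lambda>t. poly p (real t))"
  shows "h_star_poly P = h"
proof -
  have e: "ehrhart_poly P = p" using ehrhart_poly_eqI[OF p] .
  have lhs: "1 + Abs_fps (\<lambda>t. if t = 0 then 0 else poly p (real t)) = Abs_fps (\<lambda>t. poly p (real t))"
    by (rule fps_ext) (simp add: p0)
  define q where "q = ((1 - fps_X) ^ Suc d :: real fps)"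
  have nz: "q $ 0 \<noteq> 0" by (simp add: q_def fps_power_zeroth)
  have iff: "Abs_fps (\<lambda>t. poly p (real t)) = fps_of_poly g / (1 - fps_X) ^ Suc d
      \<longleftrightarrow> fps_of_poly g = (1 - fps_X) ^ Suc d * Abs_fps (\<lambda>t. poly p (real t))" for g
  proof -
    have cancel: "A = G * inverse q \<longleftrightarrow> G = q * A" for A G :: "real fps"
    proof
      assume "A = G * inverse q"
      hence "q * A = G * (inverse q * q)" by (simp only: ac_simps)
      thus "G = q * A" unfolding inverse_mult_eq_1[OF nz] by simp
    next
      assume "G = q * A"
      hence "G * inverse q = A * (inverse q * q)" by (simp only: ac_simps)
      thus "A = G * inverse q" unfolding inverse_mult_eq_1[OF nz] by simp
    qed
    show ?thesis unfolding q_def[symmetric] fps_divide_unit[OF nz] by (rule cancel)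
  qed
  have "(THE g. degree g \<le> d \<and> Abs_fps (\<lambda>t. poly p (real t)) = fps_of_poly g / (1 - fps_X) ^ Suc d) = h"
    unfolding iff
  proof (rule the_equality)
    show "degree h \<le> d \<and> fps_of_poly h = (1 - fps_X) ^ Suc d * Abs_fps (\<lambda>t. poly p (real t))"
      using h series by simp
    fix g assume "degree g \<le> d \<and> fps_of_poly g = (1 - fps_X) ^ Suc d * Abs_fps (\<lambda>t. poly p (real t))"
    thus "g = h" using series by (metis fps_of_poly_eq_iff)
  qed
  thus ?thesis unfolding h_star_poly_def e d Let_def lhs by simp
qed

text \<open>The hypothesis \<open>c 0 = 1\<close> says that the Ehrhart polynomial takes the value \<open>1\<close> at \<open>0\<close>, which the definition
  of the \<open>h\<^sup>*\<close>-polynomial prescribes for its series.\<close>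

lemma h_star_poly_magic:
  fixes P :: "(real ^ 'm) set"
  assumes d: "aff_dim P = int d"
    and count: "\<And>t. t > 0 \<Longrightarrow> real (lattice_point_count P t)
      = (\<Sum>j\<le>d. c j * (real t ^ j * (1 + real t) ^ (d - j)))"
    and c0: "c 0 = 1"
  shows "h_star_poly P = (\<Sum>j\<le>d. smult (c j) (eulerian_refinement d j))"
proof (rule h_star_poly_eqI[OF d])
  define p where "p = (\<Sum>j\<le>d. smult (c j) ([:0, 1:] ^ j * [:1, 1:] ^ (d - j)))"
  have p: "poly p x = (\<Sum>j\<le>d. c j * (x ^ j * (1 + x) ^ (d - j)))" for x
    by (simp add: p_def poly_sum)
  show "poly p (real t) = real (lattice_point_count P t)" if "t > 0" for t
    using count[OF that] by (simp add: p)
  show "poly p 0 = 1"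
    using c0 by (simp add: p power_0_left if_distrib[of "\<lambda>x. _ * x"] if_distrib[of "\<lambda>x. x * _"] sum.delta cong: if_cong)
  show "degree (\<Sum>j\<le>d. smult (c j) (eulerian_refinement d j)) \<le> d"
    by (intro degree_sum_le) (auto simp: degree_eulerian_refinement)
  have "Abs_fps (\<lambda>t. poly p (real t))
      = (\<Sum>j\<le>d. fps_const (c j) * Abs_fps (\<lambda>t. real t ^ j * (1 + real t) ^ (d - j)))"
    by (rule fps_ext) (simp add: p fps_sum_nth)
  hence "(1 - fps_X) ^ Suc d * Abs_fps (\<lambda>t. poly p (real t))
      = (\<Sum>j\<le>d. fps_const (c j) * ((1 - fps_X) ^ Suc d * Abs_fps (\<lambda>t. real t ^ j * (1 + real t) ^ (d - j))))"
    by (simp only: sum_distrib_left mult.left_commute)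
  also have "\<dots> = (\<Sum>j\<le>d. fps_const (c j) * fps_of_poly (eulerian_refinement d j))"
    by (intro sum.cong) (simp_all add: eulerian_refinement_series)
  finally show "fps_of_poly (\<Sum>j\<le>d. smult (c j) (eulerian_refinement d j))
      = (1 - fps_X) ^ Suc d * Abs_fps (\<lambda>t. poly p (real t))"
    by (simp add: fps_of_poly_sum fps_of_poly_smult)
qed

section \<open>Counting vectors with bounded subset sums\<close>

text \<open>With \<open>G = n t\<close> this is \<open>t (n + (n - 1) + \<dots> + (n - k + 1))\<close>. Keeping \<open>G\<close> and \<open>t\<close> independent
  lets the recursion lower the number of coordinates without changing \<open>G\<close>.\<close>

definition set_bound :: "nat \<Rightarrow> nat \<Rightarrow> nat \<Rightarrow> int" where
  "set_bound t G k = int G * int k - int t * int (k choose 2)"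

definition bounded_vectors :: "nat \<Rightarrow> nat \<Rightarrow> 'a set \<Rightarrow> ('a \<Rightarrow> nat) set" where
  "bounded_vectors t G U = {x. (\<forall>v. v \<notin> U \<longrightarrow> x v = 0) \<and>
     (\<forall>S\<subseteq>U. (\<Sum>v\<in>S. int (x v)) \<le> set_bound t G (card S))}"

text \<open>How far \<open>x + d\<close> is from satisfying the subset inequalities; the empty set makes it nonnegative. A further
  coordinate whose interaction with \<open>v\<close> costs \<open>d v\<close> instead of \<open>t\<close> could take the values
  \<open>0, \<dots>, G - excess\<close>.\<close>

definition excess :: "nat \<Rightarrow> nat \<Rightarrow> 'a set \<Rightarrow> ('a \<Rightarrow> nat) \<Rightarrow> ('a \<Rightarrow> nat) \<Rightarrow> int" where
  "excess t G U d x = Max ((\<lambda>S. (\<Sum>v\<in>S. int (x v) + int (d v)) - set_bound t G (card S)) ` Pow U)"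

lemma choose_two_int: "2 * int (k choose 2) = int k * (int k - 1)"
  by (induction k) (simp_all add: numeral_2_eq_2 algebra_simps)

lemma set_bound_0 [simp]: "set_bound t G 0 = 0"
  by (simp add: set_bound_def)

lemma set_bound_Suc: "set_bound t G (Suc k) = set_bound t G k + int G - int t * int k"
  by (simp add: set_bound_def numeral_2_eq_2 algebra_simps)

lemma set_bound_submodular:
  assumes "finite S" "finite T"
  shows "set_bound t G (card (S \<union> T)) + set_bound t G (card (S \<inter> T))
    \<le> set_bound t G (card S) + set_bound t G (card T)"
proof -
  define c p q where "c = card (S \<inter> T)" and "p = card (S - T)" and "q = card (T - S)"
  have S: "card S = c + p" unfolding c_def p_def
    using assms by (metis Int_commute card_Diff_subset_Int card_mono finite_Int Int_lower1 le_add_diff_inverse)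
  have T: "card T = c + q" unfolding c_def q_def
    using assms by (metis Int_commute card_Diff_subset_Int card_mono finite_Int Int_lower1 le_add_diff_inverse)
  have ST: "card (S \<union> T) = c + p + q"
    using card_Un_Int[OF assms] S T unfolding c_def by linarith
  have "2 * int (c + p choose 2) + 2 * int (c + q choose 2)
      \<le> 2 * int (c + p + q choose 2) + 2 * int (c choose 2)"
    unfolding choose_two_int by (simp add: algebra_simps)
  hence "int (c + p choose 2) + int (c + q choose 2) \<le> int (c + p + q choose 2) + int (c choose 2)"
    by linarith
  hence "int t * (int (c + p choose 2) + int (c + q choose 2))
      \<le> int t * (int (c + p + q choose 2) + int (c choose 2))"
    by (rule mult_left_mono) simp
  thus ?thesis unfolding S T ST c_def[symmetric] set_bound_def by (simp add: algebra_simps)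
qed

lemma finite_bounded_vectors:
  assumes "finite U"
  shows "finite (bounded_vectors t G U)"
proof (rule finite_subset)
  show "bounded_vectors t G U \<subseteq> {x. \<forall>v. (v \<in> U \<longrightarrow> x v \<in> {..G}) \<and> (v \<notin> U \<longrightarrow> x v = 0)}"
  proof
    fix x assume x: "x \<in> bounded_vectors t G U"
    have "x v \<le> G" if "v \<in> U" for v
    proof -
      have "(\<Sum>v\<in>{v}. int (x v)) \<le> set_bound t G (card {v})"
        using x that unfolding bounded_vectors_def by blast
      thus ?thesis by (simp add: set_bound_def numeral_2_eq_2)
    qed
    thus "x \<in> {x. \<forall>v. (v \<in> U \<longrightarrow> x v \<in> {..G}) \<and> (v \<notin> U \<longrightarrow> x v = 0)}"
      using x unfolding bounded_vectors_def by auto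
  qed
  show "finite {x. \<forall>v. (v \<in> U \<longrightarrow> x v \<in> {..G}) \<and> (v \<notin> U \<longrightarrow> x v = 0)}"
    using finite_set_of_finite_funs[OF assms finite_atMost] .
qed

lemma excess_le_iff:
  assumes "finite U"
  shows "excess t G U d x \<le> c \<longleftrightarrow>
    (\<forall>S\<subseteq>U. (\<Sum>v\<in>S. int (x v) + int (d v)) - set_bound t G (card S) \<le> c)"
  unfolding excess_def using assms by (subst Max_le_iff) auto

lemma excess_ge:
  assumes "finite U" "S \<subseteq> U"
  shows "(\<Sum>v\<in>S. int (x v) + int (d v)) - set_bound t G (card S) \<le> excess t G U d x"
  using excess_le_iff[OF assms(1), of t G d x "excess t G U d x"] assms(2) by blast

lemma excess_attained:
  assumes "finite U"
  obtains S where "S \<subseteq> U"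
    "excess t G U d x = (\<Sum>v\<in>S. int (x v) + int (d v)) - set_bound t G (card S)"
proof -
  have "excess t G U d x \<in> (\<lambda>S. (\<Sum>v\<in>S. int (x v) + int (d v)) - set_bound t G (card S)) ` Pow U"
    unfolding excess_def by (rule Max_in) (use assms in auto)
  thus ?thesis using that by auto
qed

lemma all_subsets_insert:
  "(\<forall>S\<subseteq>insert u W. P S) \<longleftrightarrow> (\<forall>S\<subseteq>W. P S) \<and> (\<forall>S\<subseteq>W. P (insert u S))"
  by (metis insert_mono subset_insert subset_insertI2 subset_insertI insert_absorb subset_insert_iff insert_Diff)

lemma excess_cong:
  assumes "\<And>v. v \<in> U \<Longrightarrow> d v = d' v" "\<And>v. v \<in> U \<Longrightarrow> x v = x' v"
  shows "excess t G U d x = excess t G U d' x'"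
proof -
  have "(\<Sum>v\<in>S. int (x v) + int (d v)) = (\<Sum>v\<in>S. int (x' v) + int (d' v))" if "S \<subseteq> U" for S
    using assms that by (intro sum.cong) auto
  thus ?thesis unfolding excess_def by (auto intro!: arg_cong[of _ _ Max] image_cong)
qed

text \<open>The maximum splits according to whether the subset contains \<open>u\<close>. Removing \<open>u\<close> from such a subset \<open>S\<close>
  lowers the bound by \<open>G - t (card S - 1)\<close>, and the second part of this acts like a shift of each remaining
  coordinate by \<open>t\<close>.\<close>

lemma excess_insert:
  assumes "finite W" "u \<notin> W"
  shows "excess t G (insert u W) d (x(u := k)) =
    max (excess t G W d x) (int (d u) - int G + excess t G W (\<lambda>v. d v + t) x + int k)"
proof -
  have ins: "(\<Sum>v\<in>insert u S. int ((x(u := k)) v) + int (d v)) - set_bound t G (card (insert u S))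
      = int (d u) - int G + int k + ((\<Sum>v\<in>S. int (x v) + int (d v + t)) - set_bound t G (card S))"
    if "S \<subseteq> W" for S
  proof -
    have S: "finite S" "u \<notin> S" using assms that finite_subset by auto
    have "(\<Sum>v\<in>S. int ((x(u := k)) v) + int (d v)) = (\<Sum>v\<in>S. int (x v) + int (d v))"
      using S by (intro sum.cong) auto
    thus ?thesis using S by (simp add: set_bound_Suc sum.distrib)
  qed
  have low: "(\<Sum>v\<in>S. int ((x(u := k)) v) + int (d v)) = (\<Sum>v\<in>S. int (x v) + int (d v))"
    if "S \<subseteq> W" for S
    using assms that by (intro sum.cong) auto
  have "excess t G (insert u W) d (x(u := k)) \<le> c \<longleftrightarrow>
      max (excess t G W d x) (int (d u) - int G + excess t G W (\<lambda>v. d v + t) x + int k) \<le> c" for c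
  proof -
    have "excess t G (insert u W) d (x(u := k)) \<le> c \<longleftrightarrow>
        (\<forall>S\<subseteq>W. (\<Sum>v\<in>S. int (x v) + int (d v)) - set_bound t G (card S) \<le> c) \<and>
        (\<forall>S\<subseteq>W. int (d u) - int G + int k +
           ((\<Sum>v\<in>S. int (x v) + int (d v + t)) - set_bound t G (card S)) \<le> c)"
      unfolding excess_le_iff[OF finite.insertI[OF assms(1)]] all_subsets_insert
      using ins low by simp
    also have "(\<forall>S\<subseteq>W. int (d u) - int G + int k +
           ((\<Sum>v\<in>S. int (x v) + int (d v + t)) - set_bound t G (card S)) \<le> c) \<longleftrightarrow>
        excess t G W (\<lambda>v. d v + t) x \<le> c - (int (d u) - int G + int k)"
      unfolding excess_le_iff[OF assms(1)] by (intro all_cong) linarith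
    also have "(\<forall>S\<subseteq>W. (\<Sum>v\<in>S. int (x v) + int (d v)) - set_bound t G (card S) \<le> c) \<longleftrightarrow>
        excess t G W d x \<le> c"
      unfolding excess_le_iff[OF assms(1)] ..
    finally show ?thesis
      by (simp only: max.bounded_iff le_diff_eq ac_simps)
  qed
  thus ?thesis by (meson order_antisym order_refl)
qed

lemma bounded_vectors_insert_iff:
  assumes "finite W" "u \<notin> W" "x u = 0"
  shows "x(u := k) \<in> bounded_vectors t G (insert u W) \<longleftrightarrow>
    x \<in> bounded_vectors t G W \<and> int k \<le> int G - excess t G W (\<lambda>_. t) x"
proof -
  have "(\<Sum>v\<in>insert u S. int ((x(u := k)) v)) \<le> set_bound t G (card (insert u S)) \<longleftrightarrow>
      (\<Sum>v\<in>S. int (x v) + int t) - set_bound t G (card S) \<le> int G - int k" if "S \<subseteq> W" for S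
  proof -
    have S: "finite S" "u \<notin> S" using assms that finite_subset by auto
    have "(\<Sum>v\<in>S. int ((x(u := k)) v)) = (\<Sum>v\<in>S. int (x v))"
      using S by (intro sum.cong) auto
    thus ?thesis using S by (auto simp add: set_bound_Suc sum.distrib algebra_simps)
  qed
  moreover have "(\<Sum>v\<in>S. int ((x(u := k)) v)) = (\<Sum>v\<in>S. int (x v))" if "S \<subseteq> W" for S
    using assms that by (intro sum.cong) auto
  moreover have "(\<forall>v. v \<notin> insert u W \<longrightarrow> (x(u := k)) v = 0) \<longleftrightarrow> (\<forall>v. v \<notin> W \<longrightarrow> x v = 0)"
    using assms by (metis fun_upd_apply insert_iff)
  ultimately show ?thesis
    unfolding bounded_vectors_def mem_Collect_eq all_subsets_insert
    using excess_le_iff[OF assms(1), of t G "\<lambda>_. t" x "int G - int k"] by auto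
qed

lemma excess_const_le:
  assumes "finite W" "x \<in> bounded_vectors t G W"
  shows "excess t G W (\<lambda>_. t) x \<le> int t * int (card W)"
  unfolding excess_le_iff[OF assms(1)]
proof (intro allI impI)
  fix S assume S: "S \<subseteq> W"
  have "card S \<le> card W" using S assms(1) by (rule card_mono[rotated])
  hence "int t * int (card S) \<le> int t * int (card W)" by (simp add: mult_left_mono)
  moreover have "(\<Sum>v\<in>S. int (x v)) \<le> set_bound t G (card S)"
    using assms(2) S unfolding bounded_vectors_def by blast
  ultimately show "(\<Sum>v\<in>S. int (x v) + int t) - set_bound t G (card S) \<le> int t * int (card W)"
    by (simp add: sum.distrib algebra_simps)
qed

text \<open>Fibration over the coordinates in \<open>W\<close>. The bound on \<open>t * card W\<close> guarantees that every vector on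
  \<open>W\<close> extends, since then \<open>0\<close> is an allowed value.\<close>

lemma sum_bounded_vectors_insert:
  fixes f :: "('a \<Rightarrow> nat) \<Rightarrow> int"
  assumes "finite W" "u \<notin> W" "t * card W \<le> G"
  shows "(\<Sum>x\<in>bounded_vectors t G (insert u W). f x) =
    (\<Sum>x\<in>bounded_vectors t G W. \<Sum>k\<le>nat (int G - excess t G W (\<lambda>_. t) x). f (x(u := k)))"
proof -
  have le: "excess t G W (\<lambda>_. t) x \<le> int G" if "x \<in> bounded_vectors t G W" for x
    using excess_const_le[OF assms(1) that] assms(3)
    by (metis of_nat_le_iff of_nat_mult order_trans)
  have zero: "x u = 0" if "x \<in> bounded_vectors t G W" for x
    using that assms(2) unfolding bounded_vectors_def by auto
  have "(\<Sum>x\<in>bounded_vectors t G W. \<Sum>k\<le>nat (int G - excess t G W (\<lambda>_. t) x). f (x(u := k)))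
     = (\<Sum>(x, k)\<in>Sigma (bounded_vectors t G W) (\<lambda>x. {..nat (int G - excess t G W (\<lambda>_. t) x)}). f (x(u := k)))"
    using finite_bounded_vectors[OF assms(1)] by (subst sum.Sigma) auto
  also have "\<dots> = (\<Sum>x\<in>bounded_vectors t G (insert u W). f x)"
  proof (rule sum.reindex_bij_witness[where j = "\<lambda>(x, k). x(u := k)" and i = "\<lambda>x. (x(u := 0), x u)"])
    fix p assume "p \<in> Sigma (bounded_vectors t G W) (\<lambda>x. {..nat (int G - excess t G W (\<lambda>_. t) x)})"
    then obtain x k where p: "p = (x, k)" "x \<in> bounded_vectors t G W"
        "k \<le> nat (int G - excess t G W (\<lambda>_. t) x)" by auto
    show "(case p of (x, k) \<Rightarrow> x(u := k)) \<in> bounded_vectors t G (insert u W)"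
      using bounded_vectors_insert_iff[where x = x and k = k and t = t and G = G, OF assms(1,2) zero[OF p(2)]] p le[OF p(2)] by simp
    show "((case p of (x, k) \<Rightarrow> x(u := k))(u := 0), (case p of (x, k) \<Rightarrow> x(u := k)) u) = p"
      using p zero[OF p(2)] by (simp add: fun_upd_idem)
    show "f (case p of (x, k) \<Rightarrow> x(u := k)) = (case p of (x, k) \<Rightarrow> f (x(u := k)))"
      using p by simp
  next
    fix x assume x: "x \<in> bounded_vectors t G (insert u W)"
    thus "(x(u := 0), x u) \<in> Sigma (bounded_vectors t G W) (\<lambda>x. {..nat (int G - excess t G W (\<lambda>_. t) x)})"
      using bounded_vectors_insert_iff[where x = "x(u := 0)" and k = "x u" and t = t and G = G, OF assms(1,2)] by auto
    show "(case (x(u := 0), x u) of (x, k) \<Rightarrow> x(u := k)) = x" by simp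
  qed
  finally show ?thesis ..
qed

definition total_excess :: "nat \<Rightarrow> nat \<Rightarrow> 'a set \<Rightarrow> ('a \<Rightarrow> nat) \<Rightarrow> int" where
  "total_excess t G U d = (\<Sum>x\<in>bounded_vectors t G U. excess t G U d x)"

lemma card_bounded_vectors_insert:
  assumes "finite W" "u \<notin> W" "t * card W \<le> G"
  shows "int (card (bounded_vectors t G (insert u W))) =
    (1 + int G) * int (card (bounded_vectors t G W)) - total_excess t G W (\<lambda>_. t)"
proof -
  have le: "excess t G W (\<lambda>_. t) x \<le> int G" if "x \<in> bounded_vectors t G W" for x
    using excess_const_le[OF assms(1) that] assms(3)
    by (metis of_nat_le_iff of_nat_mult order_trans)
  have "int (card (bounded_vectors t G (insert u W))) = (\<Sum>x\<in>bounded_vectors t G (insert u W). 1)"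
    by simp
  also have "\<dots> = (\<Sum>x\<in>bounded_vectors t G W. 1 + int G - excess t G W (\<lambda>_. t) x)"
    unfolding sum_bounded_vectors_insert[OF assms] using le by (intro sum.cong) auto
  also have "\<dots> = (1 + int G) * int (card (bounded_vectors t G W)) - total_excess t G W (\<lambda>_. t)"
    unfolding total_excess_def by (simp add: sum_subtractf mult.commute)
  finally show ?thesis .
qed

text \<open>Uncrossing: for subsets \<open>S\<close> and \<open>T\<close> attaining the two excesses on the left, the union is
  charged on the right and the intersection costs nothing because \<open>x\<close> is admissible.\<close>

lemma excess_supermodular:
  assumes "finite W" "x \<in> bounded_vectors t G W"
  shows "excess t G W (\<lambda>_. t) x + excess t G W d x \<le> excess t G W (\<lambda>v. d v + t) x"
proof -
  obtain S where S: "S \<subseteq> W"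
    "excess t G W (\<lambda>_. t) x = (\<Sum>v\<in>S. int (x v) + int t) - set_bound t G (card S)"
    using excess_attained[OF assms(1)] .
  obtain T where T: "T \<subseteq> W"
    "excess t G W d x = (\<Sum>v\<in>T. int (x v) + int (d v)) - set_bound t G (card T)"
    using excess_attained[OF assms(1)] .
  have fin: "finite S" "finite T" using S T assms(1) finite_subset by blast+
  have "(\<Sum>v\<in>S \<union> T. int (x v)) + (\<Sum>v\<in>S \<inter> T. int (x v)) = (\<Sum>v\<in>S. int (x v)) + (\<Sum>v\<in>T. int (x v))"
    using sum.union_inter[OF fin] .
  moreover have "(\<Sum>v\<in>T. int (d v)) \<le> (\<Sum>v\<in>S \<union> T. int (d v))"
    by (rule sum_mono2) (use fin in auto)
  moreover have "(\<Sum>v\<in>S. int t) \<le> (\<Sum>v\<in>S \<union> T. int t)"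
    by (rule sum_mono2) (use fin in auto)
  moreover have "(\<Sum>v\<in>S \<inter> T. int (x v)) \<le> set_bound t G (card (S \<inter> T))"
    using assms(2) S(1) unfolding bounded_vectors_def by blast
  moreover note set_bound_submodular[OF fin, of t G]
  moreover have "(\<Sum>v\<in>S \<union> T. int (x v) + int (d v + t)) - set_bound t G (card (S \<union> T))
      \<le> excess t G W (\<lambda>v. d v + t) x"
    using excess_ge[OF assms(1), of "S \<union> T" x "\<lambda>v. d v + t" t G] S T by simp
  ultimately show ?thesis unfolding S(2) T(2) of_nat_add sum.distrib by linarith
qed

lemma excess_shift_le:
  assumes "finite W"
  shows "excess t G W (\<lambda>v. d v + t) x \<le> excess t G W d x + int t * int (card W)"
  unfolding excess_le_iff[OF assms]
proof (intro allI impI)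
  fix S assume S: "S \<subseteq> W"
  have "card S \<le> card W" using S assms by (rule card_mono[rotated])
  hence "int t * int (card S) \<le> int t * int (card W)" by (simp add: mult_left_mono)
  thus "(\<Sum>v\<in>S. int (x v) + int (d v + t)) - set_bound t G (card S)
      \<le> excess t G W d x + int t * int (card W)"
    using excess_ge[OF assms S, of x d t G] by (simp add: sum.distrib algebra_simps)
qed

text \<open>Each summand is \<open>1\<close> or \<open>0\<close> according to whether \<open>Q + k \<ge> P\<close>.\<close>

lemma count_threshold:
  fixes P Q :: int
  assumes "Q \<le> P" "P - Q \<le> int b + 1"
  shows "(\<Sum>k\<le>b. max P (Q + 1 + int k) - max P (Q + int k)) = int b + 1 - (P - Q)"
proof -
  have "(\<Sum>k<b. max P (Q + 1 + int k) - max P (Q + int k)) = max P (Q + int b) - P" for b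
    using assms(1) by (induction b) (auto simp: max_def algebra_simps)
  from this[of "Suc b"] show ?thesis using assms
    by (simp add: lessThan_Suc_atMost max_def)
qed

text \<open>Along the fibre over a fixed vector on \<open>W\<close>, the excess as a function of the value \<open>k\<close> at \<open>u\<close> is
  \<open>max P (Q + k)\<close>, and raising \<open>d u\<close> raises \<open>Q\<close>. So the total excess grows by the number of \<open>k\<close> beyond the
  threshold \<open>P - Q\<close>, which is linear in the excesses on \<open>W\<close>. The threshold lies within the fibre by
  \<open>excess_shift_le\<close> and \<open>excess_supermodular\<close>.\<close>

lemma total_excess_increment:
  assumes "finite W" "u \<notin> W" "d u + t * card W \<le> G"
  shows "total_excess t G (insert u W) (d(u := Suc (d u))) - total_excess t G (insert u W) d =
    (1 + int (d u)) * int (card (bounded_vectors t G W))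
      + total_excess t G W (\<lambda>v. d v + t) - total_excess t G W d - total_excess t G W (\<lambda>_. t)"
proof -
  let ?d = "d(u := Suc (d u))"
  have tG: "t * card W \<le> G" using assms(3) by simp
  have "total_excess t G (insert u W) ?d - total_excess t G (insert u W) d
      = (\<Sum>x\<in>bounded_vectors t G W. \<Sum>k\<le>nat (int G - excess t G W (\<lambda>_. t) x).
           excess t G (insert u W) ?d (x(u := k)) - excess t G (insert u W) d (x(u := k)))"
    unfolding total_excess_def sum_subtractf[symmetric] sum_bounded_vectors_insert[OF assms(1,2) tG] ..
  also have "\<dots> = (\<Sum>x\<in>bounded_vectors t G W. 1 + int (d u) + excess t G W (\<lambda>v. d v + t) x
      - excess t G W d x - excess t G W (\<lambda>_. t) x)"
  proof (rule sum.cong[OF refl])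
    fix x assume x: "x \<in> bounded_vectors t G W"
    define b where "b = nat (int G - excess t G W (\<lambda>_. t) x)"
    define P where "P = excess t G W d x"
    define Q where "Q = int (d u) - int G + excess t G W (\<lambda>v. d v + t) x"
    have G: "int (d u) + int t * int (card W) \<le> int G"
      using assms(3) by (metis of_nat_add of_nat_le_iff of_nat_mult)
    have b: "int b = int G - excess t G W (\<lambda>_. t) x"
      unfolding b_def using excess_const_le[OF assms(1) x] G by simp
    have QP: "Q \<le> P" unfolding P_def Q_def using excess_shift_le[OF assms(1), of t G d x] G by linarith
    have PQ: "P - Q \<le> int b + 1" unfolding P_def Q_def b using excess_supermodular[OF assms(1) x, of d] by linarith
    have same: "excess t G W ?d x = P" "excess t G W (\<lambda>v. ?d v + t) x = excess t G W (\<lambda>v. d v + t) x"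
      unfolding P_def by (rule excess_cong; use assms(2) in auto)+
    have "(\<Sum>k\<le>b. excess t G (insert u W) ?d (x(u := k)) - excess t G (insert u W) d (x(u := k)))
        = (\<Sum>k\<le>b. max P (Q + 1 + int k) - max P (Q + int k))"
      unfolding excess_insert[OF assms(1,2)] same unfolding P_def Q_def
      by (intro sum.cong refl) (simp add: algebra_simps)
    also have "\<dots> = int b + 1 - (P - Q)" using count_threshold[OF QP PQ] .
    also have "\<dots> = 1 + int (d u) + excess t G W (\<lambda>v. d v + t) x - excess t G W d x - excess t G W (\<lambda>_. t) x"
      unfolding b P_def Q_def by simp
    finally show "(\<Sum>k\<le>nat (int G - excess t G W (\<lambda>_. t) x).
           excess t G (insert u W) ?d (x(u := k)) - excess t G (insert u W) d (x(u := k)))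
        = 1 + int (d u) + excess t G W (\<lambda>v. d v + t) x - excess t G W d x - excess t G W (\<lambda>_. t) x"
      unfolding b_def .
  qed
  also have "\<dots> = (1 + int (d u)) * int (card (bounded_vectors t G W))
      + total_excess t G W (\<lambda>v. d v + t) - total_excess t G W d - total_excess t G W (\<lambda>_. t)"
    unfolding total_excess_def by (simp add: sum_subtractf sum.distrib algebra_simps)
  finally show ?thesis .
qed

lemma total_excess_zero:
  assumes "finite U" "\<And>v. v \<in> U \<Longrightarrow> d v = 0"
  shows "total_excess t G U d = 0"
  unfolding total_excess_def
proof (rule sum.neutral, intro ballI)
  fix x assume x: "x \<in> bounded_vectors t G U"
  have "(\<Sum>v\<in>S. int (x v) + int (d v)) - set_bound t G (card S) \<le> 0" if "S \<subseteq> U" for S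
  proof -
    have "(\<Sum>v\<in>S. int (x v) + int (d v)) = (\<Sum>v\<in>S. int (x v))"
      using assms(2) that by (intro sum.cong) auto
    thus ?thesis using x that unfolding bounded_vectors_def by simp
  qed
  hence "excess t G U d x \<le> 0" using excess_le_iff[OF assms(1)] by blast
  moreover have "0 \<le> excess t G U d x" using excess_ge[OF assms(1), of "{}"] by simp
  ultimately show "excess t G U d x = 0" by simp
qed

text \<open>In what follows \<open>N r\<close> is the number of vectors on \<open>r\<close> coordinates, and \<open>Z r\<close> is the coefficient with which
  pairs of distinct coordinates enter the total excess, whose closed form is
  \<open>N (r - 1) \<Sum> d v (d v + 1) / 2 + Z r \<Sum> d u d v\<close> with the second sum over unordered pairs. Both are
  kept abstract, constrained by their recursions only, so that a solution can be supplied later.\<close>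

context
  fixes t G :: nat and N Z :: "nat \<Rightarrow> real"
  assumes N0: "N 0 = 1"
    and N_rec: "\<And>r. N (Suc r) = (1 + real G) * N r
       - (real r * real t * (real t + 1) * N (r - 1) + real r * (real r - 1) * (real t)\<^sup>2 * Z r) / 2"
    and Z_rec: "\<And>r. Z (Suc (Suc r)) = real t * (N r + real r * Z (Suc r))"
begin

text \<open>Induction on the total shift. The increment formula expresses the change by the polarization
  \<open>E (d + t) - E d - E t\<close> of the quadratic form in one dimension less, which is
  linear in \<open>d\<close>; the recursion for \<open>Z\<close> names its coefficient.\<close>

lemma total_excess_formula_step:
  fixes U :: "'a set"
  assumes IHN: "\<And>W :: 'a set. finite W \<Longrightarrow> card W = r \<Longrightarrow> t * (r - 1) \<le> G \<Longrightarrow>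
       real (card (bounded_vectors t G W)) = N r"
    and IHE: "\<And>(W :: 'a set) d. finite W \<Longrightarrow> card W = r \<Longrightarrow> (\<And>v. v \<in> W \<Longrightarrow> d v + t * (r - 1) \<le> G) \<Longrightarrow>
       2 * real_of_int (total_excess t G W d) =
         N (r - 1) * (\<Sum>v\<in>W. real (d v) * (real (d v) + 1))
         + Z r * ((\<Sum>v\<in>W. real (d v))\<^sup>2 - (\<Sum>v\<in>W. (real (d v))\<^sup>2))"
    and U: "finite U" "card U = Suc r"
  shows "(\<And>v. v \<in> U \<Longrightarrow> d v + t * r \<le> G) \<Longrightarrow>
     2 * real_of_int (total_excess t G U d) =
         N r * (\<Sum>v\<in>U. real (d v) * (real (d v) + 1))
         + Z (Suc r) * ((\<Sum>v\<in>U. real (d v))\<^sup>2 - (\<Sum>v\<in>U. (real (d v))\<^sup>2))"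
proof (induction "\<Sum>v\<in>U. d v" arbitrary: d)
  case 0
  hence z: "d v = 0" if "v \<in> U" for v using U(1) that by simp
  thus ?case using total_excess_zero[OF U(1), of d] by simp
next
  case (Suc s)
  then obtain u where u: "u \<in> U" "d u > 0" by (metis gr0I sum.neutral nat.distinct(1))
  define W where "W = U - {u}"
  have W: "finite W" "u \<notin> W" "U = insert u W" "card W = r"
    using U u unfolding W_def by auto
  \<comment> \<open>the shift before its last increment, which took place at \<open>u\<close>\<close>
  define e where "e = d(u := d u - 1)"
  have de: "d = e(u := Suc (e u))" using u unfolding e_def by auto
  have eW: "e v = d v" if "v \<in> W" for v using that W unfolding e_def by auto
  have sumU: "(\<Sum>v\<in>U. f (d v)) = f (Suc (e u)) + (\<Sum>v\<in>W. f (e v))"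
     "(\<Sum>v\<in>U. f (e v)) = f (e u) + (\<Sum>v\<in>W. f (e v))" for f :: "nat \<Rightarrow> 'c::comm_monoid_add"
  proof -
    have "(\<Sum>v\<in>W. f (d v)) = (\<Sum>v\<in>W. f (e v))" using eW by (intro sum.cong) auto
    thus "(\<Sum>v\<in>U. f (d v)) = f (Suc (e u)) + (\<Sum>v\<in>W. f (e v))" using W(1,2) unfolding W(3) by (simp add: de)
    show "(\<Sum>v\<in>U. f (e v)) = f (e u) + (\<Sum>v\<in>W. f (e v))" using W(1,2) unfolding W(3) by simp
  qed
  have "s = (\<Sum>v\<in>U. e v)" using sumU[of "\<lambda>x. x"] Suc(2) by simp
  moreover have eU: "e v + t * r \<le> G" if "v \<in> U" for v
    using Suc(3)[OF that] Suc(3)[OF u(1)] unfolding e_def by (auto split: if_splits)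
  ultimately have IH: "2 * real_of_int (total_excess t G U e) =
         N r * (\<Sum>v\<in>U. real (e v) * (real (e v) + 1))
         + Z (Suc r) * ((\<Sum>v\<in>U. real (e v))\<^sup>2 - (\<Sum>v\<in>U. (real (e v))\<^sup>2))"
    using Suc(1)[of e] by blast
  have rr: "t + t * (r - 1) = t * r" if "W \<noteq> {}"
    using that W by (cases r) auto
  have tr: "t * (r - 1) \<le> G" using eU[OF u(1)] by (meson add_leD2 diff_le_self le_trans mult_le_mono2)
  define D where "D = (\<Sum>v\<in>W. real (e v))"
  define Q where "Q = (\<Sum>v\<in>W. (real (e v))\<^sup>2)"
  have tE: "2 * real_of_int (total_excess t G W (\<lambda>_. t)) =
      N (r - 1) * (real r * (real t * (real t + 1))) + Z r * ((real r * real t)\<^sup>2 - real r * (real t)\<^sup>2)"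
    using IHE[OF W(1,4), of "\<lambda>_. t"] rr eU[OF u(1)] W(4) by fastforce
  have eE: "2 * real_of_int (total_excess t G W e) = N (r - 1) * (Q + D) + Z r * (D\<^sup>2 - Q)"
  proof -
    have "e v + t * (r - 1) \<le> G" if "v \<in> W" for v
      using eU[of v] that W(3) by (metis add_mono_thms_linordered_semiring(2) diff_le_self dual_order.trans insertCI mult_le_mono2)
    from IHE[OF W(1,4), of e, OF this] show ?thesis unfolding D_def Q_def
      by (simp add: sum.distrib[symmetric] distrib_left power2_eq_square)
  qed
  have etE: "2 * real_of_int (total_excess t G W (\<lambda>v. e v + t)) =
      N (r - 1) * (Q + (2 * real t + 1) * D + real r * (real t * (real t + 1)))
      + Z r * ((D + real r * real t)\<^sup>2 - (Q + 2 * real t * D + real r * (real t)\<^sup>2))"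
  proof -
    have 1: "e v + t + t * (r - 1) \<le> G" if "v \<in> W" for v
      using eU[of v] rr that W(3) by (metis add.assoc empty_iff insertCI)
    have 2: "(\<Sum>v\<in>W. real (e v + t) * (real (e v + t) + 1)) = Q + (2 * real t + 1) * D + real r * (real t * (real t + 1))"
      unfolding Q_def D_def sum_distrib_left W(4)[symmetric] of_nat_add
      by (simp add: sum.distrib[symmetric] algebra_simps power2_eq_square)
        (simp add: sum.distrib sum_distrib_left algebra_simps)?
    have 3: "(\<Sum>v\<in>W. real (e v + t)) = D + real r * real t"
      unfolding D_def W(4)[symmetric] by (simp add: sum.distrib)
    have 4: "(\<Sum>v\<in>W. (real (e v + t))\<^sup>2) = Q + 2 * real t * D + real r * (real t)\<^sup>2"
      unfolding Q_def D_def W(4)[symmetric] of_nat_add power2_sum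
      by (simp add: sum.distrib sum_distrib_left algebra_simps)
    show ?thesis using IHE[OF W(1,4), of "\<lambda>v. e v + t", OF 1] unfolding 2 3 4 .
  qed
  have step: "2 * real_of_int (total_excess t G U d) - 2 * real_of_int (total_excess t G U e)
      = 2 * (1 + real (e u)) * N r + 2 * real_of_int (total_excess t G W (\<lambda>v. e v + t))
        - 2 * real_of_int (total_excess t G W e) - 2 * real_of_int (total_excess t G W (\<lambda>_. t))"
  proof -
    have "e u + t * card W \<le> G" using eU[OF u(1)] W by simp
    from total_excess_increment[where d = e and t = t and G = G, OF W(1,2) this]
    have "real_of_int (total_excess t G U d - total_excess t G U e)
       = real_of_int ((1 + int (e u)) * int (card (bounded_vectors t G W))
      + total_excess t G W (\<lambda>v. e v + t) - total_excess t G W e - total_excess t G W (\<lambda>_. t))"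
      unfolding W(3) de[symmetric] by simp
    thus ?thesis using IHN[OF W(1,4) tr] by (simp add: algebra_simps)
  qed
  have mixed: "2 * real_of_int (total_excess t G W (\<lambda>v. e v + t))
        - 2 * real_of_int (total_excess t G W e) - 2 * real_of_int (total_excess t G W (\<lambda>_. t))
      = 2 * Z (Suc r) * D"
  proof (cases r)
    case 0
    hence "W = {}" using W by simp
    thus ?thesis unfolding etE eE tE using 0 by (simp add: D_def Q_def)
  next
    case (Suc r')
    show ?thesis unfolding etE eE tE Suc Z_rec by (simp add: algebra_simps power2_eq_square)
  qed
  have "2 * real_of_int (total_excess t G U d) = 2 * real_of_int (total_excess t G U e)
      + 2 * (1 + real (e u)) * N r + 2 * Z (Suc r) * D"
    using step mixed by linarith
  also have "\<dots> = N r * (\<Sum>v\<in>U. real (d v) * (real (d v) + 1))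
         + Z (Suc r) * ((\<Sum>v\<in>U. real (d v))\<^sup>2 - (\<Sum>v\<in>U. (real (d v))\<^sup>2))"
    unfolding IH sumU[of "\<lambda>n. real n * (real n + 1)"] sumU[of "\<lambda>n. real n"] sumU[of "\<lambda>n. (real n)\<^sup>2"]
      D_def[symmetric] Q_def[symmetric]
    by (simp add: algebra_simps power2_eq_square)
  finally show ?case .
qed

text \<open>The two claims feed each other: the number of vectors on \<open>r + 1\<close> coordinates needs the total excess on \<open>r\<close> coordinates
  for the constant shift \<open>t\<close>, and the total excess on \<open>r + 1\<close> coordinates needs both quantities on \<open>r\<close>. No
  invariance under relabelling of coordinates has to be established separately.\<close>

lemma card_bounded_vectors_and_total_excess:
  fixes U :: "'a set"
  assumes "finite U" "card U = r"
  shows "t * (r - 1) \<le> G \<Longrightarrow> real (card (bounded_vectors t G U)) = N r"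
    and "(\<And>v. v \<in> U \<Longrightarrow> d v + t * (r - 1) \<le> G) \<Longrightarrow>
     2 * real_of_int (total_excess t G U d) =
         N (r - 1) * (\<Sum>v\<in>U. real (d v) * (real (d v) + 1))
         + Z r * ((\<Sum>v\<in>U. real (d v))\<^sup>2 - (\<Sum>v\<in>U. (real (d v))\<^sup>2))"
  using assms
proof (induction r arbitrary: U d)
  case 0
  {
    case 1
    hence "U = {}" by simp
    moreover have "bounded_vectors t G ({}::'a set) = {\<lambda>_. 0}" by (auto simp: bounded_vectors_def)
    ultimately show ?case using N0 by simp
  next
    case 2
    hence "U = {}" by simp
    thus ?case using total_excess_zero[of U d t G] by simp
  }
next
  case (Suc r)
  {
    case 1
    then obtain u W where W: "U = insert u W" "u \<notin> W" "card W = r" "finite W"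
      by (metis card_Suc_eq finite_insert)
    have tr: "t * card W \<le> G" "t * (r - 1) \<le> G"
      using 1 W by (auto intro: le_trans[OF mult_le_mono2[OF diff_le_self]])
    have "t + t * (r - 1) \<le> G" if "v \<in> W" for v
    proof -
      have "r > 0" using that W card_gt_0_iff by blast
      thus ?thesis using tr W by (cases r) auto
    qed
    from Suc.IH(2)[of W "\<lambda>_. t", OF this W(4,3)] W
    have "2 * real_of_int (total_excess t G W (\<lambda>_. t)) =
      N (r - 1) * (real r * (real t * (real t + 1))) + Z r * ((real r * real t)\<^sup>2 - real r * (real t)\<^sup>2)"
      by simp
    moreover have "real (card (bounded_vectors t G U)) =
        (1 + real G) * N r - real_of_int (total_excess t G W (\<lambda>_. t))"
    proof -
      have "real_of_int (int (card (bounded_vectors t G U))) =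
        real_of_int ((1 + int G) * int (card (bounded_vectors t G W)) - total_excess t G W (\<lambda>_. t))"
        unfolding W(1) card_bounded_vectors_insert[OF W(4,2) tr(1)] ..
      thus ?thesis using Suc.IH(1)[OF tr(2) W(4,3)] by simp
    qed
    ultimately show ?case unfolding N_rec by (simp add: power2_eq_square field_simps)
  next
    case 2
    show ?case using total_excess_formula_step[of r U d] Suc.IH 2 by simp
  }
qed

end

section \<open>Lattice points of dilated partial permutohedra\<close>

no_notation fps_nth (infixl "$" 75)
notation vec_nth (infixl "$" 90)

text \<open>The sum \<open>n + (n - 1) + \<dots> + (n - k + 1)\<close>.\<close>

definition top_sum :: "nat \<Rightarrow> nat \<Rightarrow> real" where
  "top_sum n k = real n * real k - real (k choose 2)"

lemma top_sum_0 [simp]: "top_sum n 0 = 0"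
  by (simp add: top_sum_def numeral_2_eq_2)

lemma top_sum_Suc: "top_sum n (Suc k) = top_sum n k + real n - real k"
  by (simp add: top_sum_def numeral_2_eq_2 algebra_simps)

lemma top_sum_mono:
  assumes "k \<le> l" "l \<le> Suc n"
  shows "top_sum n k \<le> top_sum n l"
  using assms by (induction l rule: dec_induct) (auto simp: top_sum_Suc)

text \<open>Complementing, the numbers \<open>n - w i\<close> are distinct too, so they sum to at least \<open>0 + 1 + \<dots>\<close>.\<close>

lemma sum_distinct_le_top_sum:
  fixes w :: "'a \<Rightarrow> nat"
  assumes "finite S" "inj_on w S" "\<And>i. i \<in> S \<Longrightarrow> w i \<le> n"
  shows "(\<Sum>i\<in>S. real (w i)) \<le> top_sum n (card S)"
proof -
  have inj: "inj_on (\<lambda>i. n - w i) S"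
    using assms(2,3) unfolding inj_on_def by (metis diff_diff_cancel)
  have gauss: "\<Sum>{0..<k} = k choose 2" for k :: nat
    by (induction k) (simp_all add: numeral_2_eq_2)
  have "card S choose 2 = \<Sum>{0..<card ((\<lambda>i. n - w i) ` S)}"
    unfolding card_image[OF inj] gauss ..
  also have "\<dots> \<le> \<Sum>((\<lambda>i. n - w i) ` S)" by (rule card_sum_le_nat_sum)
  also have "\<dots> = (\<Sum>i\<in>S. n - w i)" using sum.reindex[OF inj, of "\<lambda>x. x"] by simp
  finally have "real (card S choose 2) \<le> (\<Sum>i\<in>S. real (n - w i))"
    by (metis of_nat_le_iff of_nat_sum)
  also have "\<dots> = (\<Sum>i\<in>S. real n - real (w i))"
    using assms(3) by (intro sum.cong) (auto simp: of_nat_diff)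
  finally show ?thesis unfolding top_sum_def by (simp add: sum_subtractf mult.commute)
qed

text \<open>Linear programming over the subset inequalities: give the largest value to the largest weight. In the
  induction the smallest weight \<open>c a\<close> is subtracted from all others; the part \<open>c a\<close> times the full sum is
  bounded by the inequality for the whole of \<open>J\<close>, and \<open>a\<close> gets the smallest value \<open>n - card J + 1\<close>.\<close>

lemma greedy_assignment:
  fixes c y :: "'a \<Rightarrow> real"
  assumes "finite J" "card J \<le> Suc n" "\<And>i. i \<in> J \<Longrightarrow> c i \<ge> 0"
    and "\<And>S. S \<subseteq> J \<Longrightarrow> (\<Sum>i\<in>S. y i) \<le> top_sum n (card S)"
  shows "\<exists>w :: 'a \<Rightarrow> nat. inj_on w J \<and> (\<forall>i\<in>J. n < w i + card J \<and> w i \<le> n) \<and>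
    (\<Sum>i\<in>J. real (w i)) = top_sum n (card J) \<and>
    (\<Sum>i\<in>J. c i * y i) \<le> (\<Sum>i\<in>J. c i * real (w i))"
  using assms
proof (induction "card J" arbitrary: J c)
  case 0
  thus ?case by simp
next
  case (Suc k)
  have "finite (c ` J)" "c ` J \<noteq> {}" using Suc(2,3) by auto
  hence "Min (c ` J) \<in> c ` J" by (rule Min_in)
  then obtain a where a: "a \<in> J" "c a = Min (c ` J)" by auto
  hence amin: "c a \<le> c i" if "i \<in> J" for i using that Suc(3) by simp
  \<comment> \<open>\<open>a\<close> carries the smallest weight, which is subtracted from the others below\<close>
  define J' where "J' = J - {a}"
  have J': "finite J'" "card J' = k" "a \<notin> J'" "J = insert a J'"
    using Suc(2,3) a unfolding J'_def by auto
  have "\<exists>w :: 'a \<Rightarrow> nat. inj_on w J' \<and> (\<forall>i\<in>J'. n < w i + card J' \<and> w i \<le> n) \<and>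
    (\<Sum>i\<in>J'. real (w i)) = top_sum n (card J') \<and>
    (\<Sum>i\<in>J'. (c i - c a) * y i) \<le> (\<Sum>i\<in>J'. (c i - c a) * real (w i))"
  proof (rule Suc(1))
    show "k = card J'" "finite J'" using J' by auto
    show "card J' \<le> Suc n" using J' Suc(2,4) by simp
    show "c i - c a \<ge> 0" if "i \<in> J'" for i using amin that J' by simp
    show "(\<Sum>i\<in>S. y i) \<le> top_sum n (card S)" if "S \<subseteq> J'" for S
      using Suc(6) that J' by blast
  qed
  then obtain w where w: "inj_on w J'" "\<And>i. i \<in> J' \<Longrightarrow> n < w i + k \<and> w i \<le> n"
    "(\<Sum>i\<in>J'. real (w i)) = top_sum n k"
    "(\<Sum>i\<in>J'. (c i - c a) * y i) \<le> (\<Sum>i\<in>J'. (c i - c a) * real (w i))"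
    using J'(2) by auto
  define w' where "w' = w(a := n - k)"
  have kn: "k \<le> n" using Suc(2,4) by simp
  have w'J: "w' i = w i" if "i \<in> J'" for i using that J' unfolding w'_def by auto
  have 1: "inj_on w' J"
  proof -
    have "n - k < w i" if "i \<in> J'" for i using w(2)[OF that] kn by linarith
    hence "w' a \<notin> w ` J'" unfolding w'_def by (metis fun_upd_same imageE less_irrefl)
    moreover have "inj_on w' J'" "w' ` J' = w ` J'" using w(1) w'J unfolding inj_on_def by auto
    ultimately show ?thesis unfolding J'(4) by auto
  qed
  have 2: "n < w' i + card J \<and> w' i \<le> n" if "i \<in> J" for i
    using that w(2)[of i] w'J[of i] kn Suc(2) J'(4) by (cases "i = a") (auto simp: w'_def)
  have 3: "(\<Sum>i\<in>J. real (w' i)) = top_sum n (card J)"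
  proof -
    have "(\<Sum>i\<in>J. real (w' i)) = real (n - k) + (\<Sum>i\<in>J'. real (w i))"
      using J' w'J by (simp add: w'_def)
    thus ?thesis using w(3) kn Suc(2)[symmetric] by (simp add: top_sum_Suc of_nat_diff)
  qed
  have split: "(\<Sum>i\<in>J. c i * g i) = (\<Sum>i\<in>J'. (c i - c a) * g i) + c a * (\<Sum>i\<in>J. g i)" for g
    using J' by (simp add: sum_distrib_left left_diff_distrib sum_subtractf algebra_simps)
  have "c a * (\<Sum>i\<in>J. y i) \<le> c a * (\<Sum>i\<in>J. real (w' i))"
    unfolding 3 using Suc(5)[OF a(1)] Suc(6)[of J] by (intro mult_left_mono) auto
  moreover have "(\<Sum>i\<in>J'. (c i - c a) * real (w i)) = (\<Sum>i\<in>J'. (c i - c a) * real (w' i))"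
    using w'J by (intro sum.cong) auto
  ultimately have "(\<Sum>i\<in>J. c i * y i) \<le> (\<Sum>i\<in>J. c i * real (w' i))"
    unfolding split using w(4) by linarith
  thus ?case using 1 2 3 by blast
qed

text \<open>A point outside the hull is separated from it by a linear functional. Only coordinates with positive weight
  matter when maximizing a functional over the generators, and the greedy assignment on these yields a generator that
  is at least as good as the point. The hypothesis on \<open>n\<close> provides enough distinct values.\<close>

lemma mem_partial_permutohedron_iff:
  fixes y :: "real ^ 'm"
  assumes n: "CARD('m::finite) \<le> Suc n"
  shows "y \<in> partial_permutohedron n \<longleftrightarrow>
    (\<forall>i. y $ i \<ge> 0) \<and> (\<forall>S. (\<Sum>i\<in>S. y $ i) \<le> top_sum n (card S))"
proof
  let ?V = "{v :: real ^ 'm. (\<forall>i. \<exists>k\<le>n. v $ i = real k) \<and>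
         (\<forall>i j. i \<noteq> j \<and> v $ i \<noteq> 0 \<and> v $ j \<noteq> 0 \<longrightarrow> v $ i \<noteq> v $ j)}"
  let ?Q = "{y :: real ^ 'm. (\<forall>i. y $ i \<ge> 0) \<and> (\<forall>S. (\<Sum>i\<in>S. y $ i) \<le> top_sum n (card S))}"
  {
    have "?V \<subseteq> ?Q"
    proof
      fix v assume v: "v \<in> ?V"
      then obtain w where w: "\<And>i. w i \<le> n" "\<And>i. v $ i = real (w i)" by simp metis
      have "(\<Sum>i\<in>S. v $ i) \<le> top_sum n (card S)" for S
      proof -
        let ?S = "{i\<in>S. w i \<noteq> 0}"
        have "inj_on w ?S" using v w(2) unfolding inj_on_def by simp metis
        hence "(\<Sum>i\<in>?S. real (w i)) \<le> top_sum n (card ?S)"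
          by (intro sum_distinct_le_top_sum) (use w in auto)
        also have "\<dots> \<le> top_sum n (card S)"
        proof (rule top_sum_mono)
          show "card ?S \<le> card S" by (rule card_mono) auto
          have "card S \<le> CARD('m)" by (rule card_mono) auto
          thus "card S \<le> Suc n" using n by simp
        qed
        finally show ?thesis unfolding w(2)
          by (subst (asm) sum.mono_neutral_left[of S]) auto
      qed
      thus "v \<in> ?Q" using w by simp
    qed
    moreover have "convex ?Q"
    proof (rule convexI)
      fix x y :: "real ^ 'm" and u v :: real
      assume x: "x \<in> ?Q" and y: "y \<in> ?Q" and uv: "0 \<le> u" "0 \<le> v" "u + v = 1"
      have "(\<Sum>i\<in>S. (u *\<^sub>R x + v *\<^sub>R y) $ i) \<le> top_sum n (card S)" for S
      proof -
        have "(\<Sum>i\<in>S. (u *\<^sub>R x + v *\<^sub>R y) $ i) = u * (\<Sum>i\<in>S. x $ i) + v * (\<Sum>i\<in>S. y $ i)"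
          by (simp add: sum.distrib sum_distrib_left)
        also have "\<dots> \<le> u * top_sum n (card S) + v * top_sum n (card S)"
          using x y uv by (intro add_mono mult_left_mono) auto
        also have "\<dots> = top_sum n (card S)" using uv by (simp add: distrib_right[symmetric])
        finally show ?thesis .
      qed
      thus "u *\<^sub>R x + v *\<^sub>R y \<in> ?Q" using x y uv by simp
    qed
    ultimately have sub: "partial_permutohedron n \<subseteq> ?Q"
      unfolding partial_permutohedron_def by (rule hull_minimal)
    assume "y \<in> partial_permutohedron n"
    thus "(\<forall>i. y $ i \<ge> 0) \<and> (\<forall>S. (\<Sum>i\<in>S. y $ i) \<le> top_sum n (card S))" using sub by auto
  next
    assume y: "(\<forall>i. y $ i \<ge> 0) \<and> (\<forall>S. (\<Sum>i\<in>S. y $ i) \<le> top_sum n (card S))"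
    have "finite ?V"
    proof (rule finite_subset)
      show "?V \<subseteq> (\<lambda>w. \<chi> i. real (w i)) ` (PiE UNIV (\<lambda>_. {..n}))"
      proof
        fix v assume "v \<in> ?V"
        then obtain w where w: "\<And>i. w i \<le> n" "\<And>i. v $ i = real (w i)" by simp metis
        hence "v = (\<chi> i. real (w i))" "w \<in> PiE UNIV (\<lambda>_. {..n})" by (auto simp: vec_eq_iff)
        thus "v \<in> (\<lambda>w. \<chi> i. real (w i)) ` (PiE UNIV (\<lambda>_. {..n}))" by blast
      qed
    qed (intro finite_imageI finite_PiE, auto)
    hence "closed (partial_permutohedron n :: (real ^ 'm) set)"
      unfolding partial_permutohedron_def
      by (intro compact_imp_closed finite_imp_compact_convex_hull)
    moreover have "convex (partial_permutohedron n :: (real ^ 'm) set)"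
      unfolding partial_permutohedron_def by (rule convex_convex_hull)
    moreover {
      fix a :: "real ^ 'm" and b
      assume ab: "inner a y < b" "\<forall>x\<in>partial_permutohedron n. b < inner a x"
      \<comment> \<open>the separating functional is smaller at \<open>y\<close>, so \<open>- a\<close> is the one to be maximized\<close>
      define J where "J = {i. a $ i < 0}"
      have "card J \<le> CARD('m)" by (rule card_mono) auto
      then obtain w :: "'m \<Rightarrow> nat" where w: "inj_on w J" "\<And>i. i \<in> J \<Longrightarrow> w i \<le> n"
        "(\<Sum>i\<in>J. - (a $ i) * y $ i) \<le> (\<Sum>i\<in>J. - (a $ i) * real (w i))"
        using greedy_assignment[of J n "\<lambda>i. - (a $ i)" "\<lambda>i. y $ i"] y n
        unfolding J_def by fastforce
      define v :: "real ^ 'm" where "v = (\<chi> i. if i \<in> J then real (w i) else 0)"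
      have "v \<in> ?V" using w(1,2) unfolding v_def inj_on_def by auto
      hence "v \<in> partial_permutohedron n"
        unfolding partial_permutohedron_def by (rule hull_inc)
      hence "b < inner a v" using ab by blast
      also have "inner a v = (\<Sum>i\<in>UNIV. if i \<in> J then a $ i * real (w i) else 0)"
        unfolding inner_vec_def v_def by (intro sum.cong) auto
      also have "\<dots> = (\<Sum>i\<in>J. a $ i * real (w i))" by (simp add: sum.If_cases)
      also have "\<dots> \<le> (\<Sum>i\<in>J. a $ i * y $ i)" using w(3) by (simp add: sum_negf)
      also have "\<dots> \<le> (\<Sum>i\<in>UNIV. a $ i * y $ i)"
        using y by (intro sum_mono2) (auto simp: J_def)
      also have "\<dots> = inner a y" by (simp add: inner_vec_def)
      finally have False using ab by simp
    }
    ultimately show "y \<in> partial_permutohedron n"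
      using separating_hyperplane_closed_point by blast
  }
qed

lemma lattice_point_count_partial_permutohedron:
  assumes n: "CARD('m::finite) \<le> Suc n" and t: "t > 0"
  shows "lattice_point_count (partial_permutohedron n :: (real ^ 'm) set) t
    = card (bounded_vectors t (n * t) (UNIV :: 'm set))"
proof -
  let ?vec = "\<lambda>x. \<chi> i::'m. real (x i)"
  have bound: "real_of_int (set_bound t (n * t) k) = real t * top_sum n k" for k
    by (simp add: set_bound_def top_sum_def algebra_simps)
  have mem: "z \<in> (\<lambda>x. real t *\<^sub>R x) ` partial_permutohedron n \<longleftrightarrow>
      (\<forall>i. z $ i \<ge> 0) \<and> (\<forall>S. (\<Sum>i\<in>S. z $ i) \<le> real t * top_sum n (card S))" for z :: "real ^ 'm"
  proof -
    have "z \<in> (\<lambda>x. real t *\<^sub>R x) ` partial_permutohedron n \<longleftrightarrow> (1 / real t) *\<^sub>R z \<in> partial_permutohedron n"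
      using t by (auto simp: image_iff intro!: bexI[of _ "(1 / real t) *\<^sub>R z"])
    thus ?thesis unfolding mem_partial_permutohedron_iff[OF n]
      using t by (simp add: sum_divide_distrib[symmetric] field_simps)
  qed
  have mem_vec: "?vec x \<in> (\<lambda>x. real t *\<^sub>R x) ` partial_permutohedron n \<longleftrightarrow>
      x \<in> bounded_vectors t (n * t) UNIV" for x
  proof -
    have "(\<Sum>i\<in>S. real (x i)) \<le> real t * top_sum n (card S) \<longleftrightarrow>
        (\<Sum>i\<in>S. int (x i)) \<le> set_bound t (n * t) (card S)" for S
      unfolding bound[symmetric]
      by (subst of_int_le_iff[where 'a = real, symmetric]) simp
    thus ?thesis unfolding mem bounded_vectors_def by simp
  qed
  have "(\<lambda>x. real t *\<^sub>R x) ` partial_permutohedron n \<inter> {x. \<forall>i. x $ i \<in> \<int>}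
      = ?vec ` bounded_vectors t (n * t) UNIV"
  proof (intro subset_antisym subsetI)
    fix z :: "real ^ 'm"
    assume z: "z \<in> (\<lambda>x. real t *\<^sub>R x) ` partial_permutohedron n \<inter> {x. \<forall>i. x $ i \<in> \<int>}"
    hence "z $ i \<in> \<nat>" for i using mem[of z] by (simp add: Nats_altdef2)
    hence "\<forall>i. \<exists>k. z $ i = real k" by (auto elim!: Nats_cases)
    then obtain x where "\<And>i. z $ i = real (x i)" by metis
    hence "z = ?vec x" by (simp add: vec_eq_iff)
    thus "z \<in> ?vec ` bounded_vectors t (n * t) UNIV" using z mem_vec by blast
  next
    fix z assume "z \<in> ?vec ` bounded_vectors t (n * t) UNIV"
    thus "z \<in> (\<lambda>x. real t *\<^sub>R x) ` partial_permutohedron n \<inter> {x. \<forall>i. x $ i \<in> \<int>}"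
      using mem_vec by auto
  qed
  moreover have "inj ?vec" by (auto simp: inj_def vec_eq_iff)
  ultimately show ?thesis unfolding lattice_point_count_def
    by (simp add: card_image inj_on_subset)
qed

text \<open>The polytope contains the origin and all unit vectors.\<close>

lemma aff_dim_partial_permutohedron:
  assumes "n \<ge> 1"
  shows "aff_dim (partial_permutohedron n :: (real ^ 'm::finite) set) = int CARD('m)"
proof -
  let ?P = "partial_permutohedron n :: (real ^ 'm) set"
  have gen: "v \<in> ?P" if "(\<forall>i. \<exists>k\<le>n. v $ i = real k) \<and>
         (\<forall>i j. i \<noteq> j \<and> v $ i \<noteq> 0 \<and> v $ j \<noteq> 0 \<longrightarrow> v $ i \<noteq> v $ j)" for v
    unfolding partial_permutohedron_def by (rule hull_inc) (use that in simp)
  have zero: "0 \<in> ?P" by (rule gen) auto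
  have "axis i 1 \<in> ?P" for i :: 'm
  proof (rule gen, intro conjI allI)
    fix j show "\<exists>k\<le>n. axis i 1 $ j = real k"
      using assms by (cases "i = j") (auto simp: axis_def intro: exI[of _ 0] exI[of _ 1])
  qed (auto simp: axis_def)
  hence "Basis \<subseteq> ?P" by (auto simp: Basis_vec_def)
  hence "span ?P = UNIV" using span_Basis span_mono by blast
  hence "affine hull ?P = UNIV" using affine_hull_span_0[of ?P] zero hull_inc by metis
  thus ?thesis using aff_dim_eq_full[of ?P] by simp
qed

section \<open>Tree series and Lagrange inversion\<close>

no_notation vec_nth (infixl "$" 90)
notation fps_nth (infixl "$" 75)

definition nonneg_coeffs :: "real fps \<Rightarrow> bool" where
  "nonneg_coeffs f \<longleftrightarrow> (\<forall>k. f $ k \<ge> 0)"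

lemma nonneg_coeffs_1 [simp]: "nonneg_coeffs 1"
  by (simp add: nonneg_coeffs_def)

lemma nonneg_coeffs_X [simp]: "nonneg_coeffs fps_X"
  by (simp add: nonneg_coeffs_def fps_X_def)

lemma nonneg_coeffs_const: "c \<ge> 0 \<Longrightarrow> nonneg_coeffs (fps_const c)"
  by (simp add: nonneg_coeffs_def)

lemma nonneg_coeffs_add: "nonneg_coeffs f \<Longrightarrow> nonneg_coeffs g \<Longrightarrow> nonneg_coeffs (f + g)"
  by (simp add: nonneg_coeffs_def)

lemma nonneg_coeffs_mult: "nonneg_coeffs f \<Longrightarrow> nonneg_coeffs g \<Longrightarrow> nonneg_coeffs (f * g)"
  by (simp add: nonneg_coeffs_def fps_mult_nth sum_nonneg)

lemma nonneg_coeffs_power: "nonneg_coeffs f \<Longrightarrow> nonneg_coeffs (f ^ j)"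
  by (induction j) (simp_all add: nonneg_coeffs_mult)

lemma nonneg_coeffs_compose: "nonneg_coeffs f \<Longrightarrow> nonneg_coeffs g \<Longrightarrow> nonneg_coeffs (f oo g)"
  using nonneg_coeffs_power[of g] by (simp add: nonneg_coeffs_def fps_compose_nth sum_nonneg)

lemma nonneg_coeffs_exp: "c \<ge> 0 \<Longrightarrow> nonneg_coeffs (fps_exp c)"
  by (simp add: nonneg_coeffs_def)

text \<open>The solution of \<open>T = y e\<^sup>T\<close>, the exponential generating function of rooted labelled trees.\<close>

definition tree_fps :: "real fps" where
  "tree_fps = fps_inv (fps_X * fps_exp (- 1))"

lemma tree_fps_0 [simp]: "tree_fps $ 0 = 0"
  by (simp add: tree_fps_def fps_inv_def)

lemma compose_tree_fps_mult: "(f * g) oo tree_fps = (f oo tree_fps) * (g oo tree_fps)"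
  by (rule fps_compose_mult_distrib) simp

lemma X_exp_compose_tree_fps: "(fps_X * fps_exp (- 1)) oo tree_fps = fps_X"
  unfolding tree_fps_def by (rule fps_inv_right) simp_all

lemma exp_neg_mult_exp: "fps_exp (- 1) * fps_exp 1 = (1 :: real fps)"
  by (simp flip: fps_exp_add_mult)

lemma tree_fps_eq: "tree_fps = fps_X * (fps_exp 1 oo tree_fps)"
proof -
  have "tree_fps = (fps_X * (fps_exp (- 1) * fps_exp 1)) oo tree_fps"
    by (simp add: exp_neg_mult_exp)
  also have "\<dots> = ((fps_X * fps_exp (- 1)) oo tree_fps) * (fps_exp 1 oo tree_fps)"
    by (simp only: mult.assoc[symmetric] compose_tree_fps_mult)
  finally show ?thesis unfolding X_exp_compose_tree_fps .
qed

lemma tree_fps_1 [simp]: "tree_fps $ Suc 0 = 1"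
  by (subst tree_fps_eq) simp

lemma one_minus_X_mult_exp_nth:
  "((1 - fps_X) * fps_exp (a :: real)) $ Suc i = a ^ i / fact (Suc i) * (a - real (Suc i))"
proof -
  have "a ^ i / fact i = a ^ i * real (Suc i) / fact (Suc i)"
    by (simp add: divide_simps)
  moreover have "((1 - fps_X) * fps_exp a) $ Suc i = a * a ^ i / fact (Suc i) - a ^ i / fact i"
    by (simp add: left_diff_distrib) (simp add: distrib_right)
  ultimately show ?thesis
    by (simp only: right_diff_distrib left_diff_distrib diff_divide_distrib times_divide_eq_left
        times_divide_eq_right mult.commute)
qed

text \<open>Both sides are linear in \<open>H\<close>, agree on constants, and under \<open>H = x e\<^bsup>-x\<^esup> K\<close> both drop to the
  index \<open>m - 1\<close> and the series \<open>K\<close>; every series is a constant plus such a multiple.\<close>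

lemma Lagrange_inversion_tree_fps:
  "(H oo tree_fps) $ m = (H * ((1 - fps_X) * fps_exp (real m))) $ m"
proof (induction m arbitrary: H)
  case 0
  then show ?case by simp
next
  case (Suc m)
  define h where "h = H $ 0"
  \<comment> \<open>chosen so that \<open>H\<close> is a constant plus \<open>x e\<^bsup>-x\<^esup> K\<close>\<close>
  define K where "K = fps_shift 1 H * fps_exp 1"
  have H: "H = fps_const h + (fps_X * fps_exp (- 1)) * K"
  proof -
    have "(fps_X * fps_exp (- 1)) * K = fps_shift 1 H * fps_X * (fps_exp (- 1) * fps_exp 1)"
      unfolding K_def by (simp only: ac_simps)
    also have "fps_const h + \<dots> = H"
      unfolding exp_neg_mult_exp by (rule fps_ext) (auto simp: h_def split: nat.splits)
    finally show ?thesis ..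
  qed
  have "(H oo tree_fps) $ Suc m = (K oo tree_fps) $ m"
    unfolding H fps_compose_add_distrib compose_tree_fps_mult[of _ K] X_exp_compose_tree_fps by simp
  also have "\<dots> = (K * ((1 - fps_X) * fps_exp (real m))) $ m" by (rule Suc)
  also have "\<dots> = (H * ((1 - fps_X) * fps_exp (real (Suc m)))) $ Suc m"
  proof -
    have "fps_exp (- 1) * fps_exp (real (Suc m)) = fps_exp (real m)"
      by (simp flip: fps_exp_add_mult)
    hence "(fps_X * fps_exp (- 1)) * K * ((1 - fps_X) * fps_exp (real (Suc m)))
        = fps_X * (K * ((1 - fps_X) * fps_exp (real m)))"
      by (simp only: ac_simps) (simp only: mult.assoc[symmetric])?
    hence "H * ((1 - fps_X) * fps_exp (real (Suc m))) = fps_const h * ((1 - fps_X) * fps_exp (real (Suc m)))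
        + fps_X * (K * ((1 - fps_X) * fps_exp (real m)))"
      by (subst H) (simp only: distrib_right)
    thus ?thesis using one_minus_X_mult_exp_nth[of "real (Suc m)" m] by simp
  qed
  finally show ?case .
qed

lemma nonneg_coeffs_tree_fps: "nonneg_coeffs tree_fps"
  unfolding nonneg_coeffs_def
proof
  fix k
  show "tree_fps $ k \<ge> 0"
  proof (cases k)
    case (Suc j)
    have "tree_fps $ k = ((1 - fps_X) * fps_exp (real k)) $ j"
      using Lagrange_inversion_tree_fps[of fps_X k] Suc by simp
    also have "\<dots> \<ge> 0"
    proof (cases j)
      case (Suc i)
      show ?thesis unfolding Suc one_minus_X_mult_exp_nth using \<open>k = Suc j\<close> Suc by simp
    qed simp
    finally show ?thesis .
  qed simp
qed

text \<open>Trees have one vertex more than edges: subtracting from the trees rooted at a vertex those rooted at an edge, which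
  are unordered pairs of rooted trees, leaves the unrooted ones.\<close>

definition unrooted_tree_fps :: "real fps" where
  "unrooted_tree_fps = tree_fps - fps_const (1/2) * tree_fps\<^sup>2"

lemma unrooted_tree_fps_nth: "real k * unrooted_tree_fps $ k = tree_fps $ k"
proof -
  have "fps_deriv tree_fps = fps_deriv (fps_X * (fps_exp 1 oo tree_fps))"
    by (subst tree_fps_eq) (rule refl)
  also have "\<dots> = (fps_exp 1 oo tree_fps) + fps_X * (fps_exp 1 oo tree_fps) * fps_deriv tree_fps"
    by (simp add: fps_compose_deriv)
  also have "fps_X * (fps_exp 1 oo tree_fps) = tree_fps" by (rule tree_fps_eq[symmetric])
  finally have "fps_deriv tree_fps - tree_fps * fps_deriv tree_fps = fps_exp 1 oo tree_fps"
    by (simp add: algebra_simps)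
  moreover have "fps_deriv unrooted_tree_fps = fps_deriv tree_fps - tree_fps * fps_deriv tree_fps"
  proof -
    have "fps_const (1/2) * (f + f) = f" for f :: "real fps" by (rule fps_ext) simp
    thus ?thesis unfolding unrooted_tree_fps_def power2_eq_square by (simp add: mult.commute)
  qed
  ultimately have "fps_X * fps_deriv unrooted_tree_fps = tree_fps"
    using tree_fps_eq by simp
  hence "(fps_X * fps_deriv unrooted_tree_fps) $ k = tree_fps $ k" by simp
  thus ?thesis by (cases k) auto
qed

lemma nonneg_coeffs_unrooted_tree_fps: "nonneg_coeffs unrooted_tree_fps"
  unfolding nonneg_coeffs_def
proof
  fix k show "unrooted_tree_fps $ k \<ge> 0"
  proof (cases k)
    case 0
    thus ?thesis by (simp add: unrooted_tree_fps_def power2_eq_square)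
  next
    case (Suc j)
    have "real k * unrooted_tree_fps $ k \<ge> 0"
      unfolding unrooted_tree_fps_nth using nonneg_coeffs_tree_fps by (simp add: nonneg_coeffs_def)
    thus ?thesis using Suc by (simp add: zero_le_mult_iff)
  qed
qed

text \<open>The exponent of \<open>r = (1 + t)/t\<close>; composed with \<open>tree_fps\<close> it becomes \<open>component_fps\<close>.\<close>

definition quad_fps :: "real fps" where
  "quad_fps = fps_X - fps_const (1/4) * fps_X\<^sup>2"

lemma quad_fps_compose_tree: "quad_fps oo tree_fps = unrooted_tree_fps + fps_const (1/4) * tree_fps\<^sup>2"
proof -
  have "quad_fps oo tree_fps = tree_fps - fps_const (1/4) * tree_fps\<^sup>2"
    unfolding quad_fps_def fps_compose_sub_distrib compose_tree_fps_mult power2_eq_square by simp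
  also have "fps_const (1/4) = fps_const (1/2) - fps_const (1/4 :: real)" by simp
  finally show ?thesis unfolding unrooted_tree_fps_def by (simp add: left_diff_distrib del: fps_const_sub)
qed

text \<open>The series \<open>x + x\<^sup>2 / (2 (1 - x))\<close>, the logarithmic derivative of \<open>cycle_fps\<close>.\<close>

definition cycle_rate_fps :: "real fps" where
  "cycle_rate_fps = Abs_fps (\<lambda>k. if k = 0 then 0 else if k = 1 then 1 else 1/2)"

text \<open>The series \<open>K(x) = (1 - x)\<^bsup>-1/2\<^esup> e\<^bsup>-x/2 + x\<^sup>2/4\<^esup>\<close>, written as the exponential of
  \<open>x\<^sup>2/2 + \<Sum>\<^bsub>i\<ge>3\<^esub> x\<^sup>i / (2 i)\<close> to make its nonnegativity evident; \<open>x\<^sup>i / (2 i)\<close> counts undirected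
  cycles of length \<open>i \<ge> 3\<close>.\<close>

definition cycle_fps :: "real fps" where
  "cycle_fps = fps_exp 1 oo fps_integral0 cycle_rate_fps"

lemma one_minus_X_mult_cycle_rate:
  "(1 - fps_X) * cycle_rate_fps = fps_X - fps_const (1/2) * fps_X\<^sup>2"
proof (rule fps_ext)
  fix k show "((1 - fps_X) * cycle_rate_fps) $ k = (fps_X - fps_const (1/2) * fps_X\<^sup>2) $ k"
    by (cases k; cases "k - 1"; cases "k - 2")
      (auto simp: cycle_rate_fps_def left_diff_distrib fps_X_power_iff)
qed

lemma cycle_fps_deriv: "fps_deriv cycle_fps = cycle_fps * cycle_rate_fps"
  unfolding cycle_fps_def by (simp add: fps_compose_deriv fps_deriv_fps_integral)

lemma nonneg_coeffs_cycle_fps: "nonneg_coeffs cycle_fps"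
  unfolding cycle_fps_def
proof (intro nonneg_coeffs_compose nonneg_coeffs_exp)
  show "nonneg_coeffs (fps_integral0 cycle_rate_fps)"
    by (auto simp: nonneg_coeffs_def cycle_rate_fps_def fps_integral_def)
qed simp

lemma cycle_fps_Suc:
  "real (Suc k) * cycle_fps $ Suc k = (\<Sum>i=0..k. cycle_fps $ i * cycle_rate_fps $ (k - i))"
  using arg_cong[OF cycle_fps_deriv, of "\<lambda>f. f $ k"] by (simp add: fps_mult_nth)

lemma cycle_fps_small:
  "cycle_fps $ 0 = 1" "cycle_fps $ 1 = 0" "cycle_fps $ 2 = 1/2" "cycle_fps $ 3 = 1/6" "cycle_fps $ 4 = 1/4"
proof -
  show 0: "cycle_fps $ 0 = 1" by (simp add: cycle_fps_def)
  show 1: "cycle_fps $ 1 = 0" using cycle_fps_Suc[of 0] by (simp add: cycle_rate_fps_def)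
  show 2: "cycle_fps $ 2 = 1/2" using cycle_fps_Suc[of 1] 0 1
    by (simp add: cycle_rate_fps_def numeral_eq_Suc)
  show 3: "cycle_fps $ 3 = 1/6" using cycle_fps_Suc[of 2] 0 1 2
    by (simp add: cycle_rate_fps_def numeral_eq_Suc)
  show "cycle_fps $ 4 = 1/4" using cycle_fps_Suc[of 3] 0 1 2 3
    by (simp add: cycle_rate_fps_def numeral_eq_Suc)
qed

text \<open>The part of the count that does not involve \<open>r\<close>.\<close>

definition base_fps :: "nat \<Rightarrow> real fps" where
  "base_fps n = (1 - fps_X) * (fps_exp (real n) * cycle_fps)"

text \<open>The factor \<open>1 - x\<close> of \<open>base_fps\<close> is the one that Lagrange inversion asks for, and the exponential splits off
  \<open>e\<^bsup>mx\<^esup>\<close>.\<close>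

lemma base_fps_Lagrange:
  "(quad_fps ^ j * base_fps n) $ m
     = ((quad_fps oo tree_fps) ^ j * ((fps_exp (real n - real m) * cycle_fps) oo tree_fps)) $ m"
proof -
  have "fps_exp (real n) = fps_exp (real n - real m) * fps_exp (real m)"
    by (simp flip: fps_exp_add_mult)
  hence "quad_fps ^ j * base_fps n
      = (quad_fps ^ j * (fps_exp (real n - real m) * cycle_fps)) * ((1 - fps_X) * fps_exp (real m))"
    unfolding base_fps_def by (simp only: ac_simps)
  thus ?thesis
    by (simp only: Lagrange_inversion_tree_fps[symmetric] compose_tree_fps_mult
        fps_compose_power[OF tree_fps_0, symmetric])
qed

lemma nonneg_coeffs_quad_fps_compose_tree: "nonneg_coeffs (quad_fps oo tree_fps)"
  unfolding quad_fps_compose_tree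
  by (intro nonneg_coeffs_add nonneg_coeffs_mult nonneg_coeffs_power nonneg_coeffs_const
      nonneg_coeffs_tree_fps nonneg_coeffs_unrooted_tree_fps) simp

lemma base_fps_nonneg:
  assumes "m \<le> n"
  shows "(quad_fps ^ j * base_fps n) $ m \<ge> 0"
proof -
  have "nonneg_coeffs ((quad_fps oo tree_fps) ^ j * ((fps_exp (real n - real m) * cycle_fps) oo tree_fps))"
    using assms by (intro nonneg_coeffs_mult nonneg_coeffs_power nonneg_coeffs_compose nonneg_coeffs_exp
      nonneg_coeffs_cycle_fps nonneg_coeffs_tree_fps nonneg_coeffs_quad_fps_compose_tree) simp
  thus ?thesis unfolding base_fps_Lagrange nonneg_coeffs_def by blast
qed

section \<open>Positivity in the boundary case\<close>

text \<open>The factor \<open>e\<^bsup>(n-m)T\<^esup> K(T)\<close> for \<open>n = m - 1\<close>.\<close>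

definition boundary_fps :: "real fps" where
  "boundary_fps = (fps_exp (- 1) * cycle_fps) oo tree_fps"

lemma boundary_fps_nth: "boundary_fps $ k = (cycle_fps * ((1 - fps_X) * fps_exp (real k - 1))) $ k"
proof -
  have "fps_exp (real k - 1) = fps_exp (- 1) * fps_exp (real k)"
    by (simp flip: fps_exp_add_mult)
  hence "cycle_fps * ((1 - fps_X) * fps_exp (real k - 1))
      = (fps_exp (- 1) * cycle_fps) * ((1 - fps_X) * fps_exp (real k))"
    by (simp only: ac_simps)
  thus ?thesis unfolding boundary_fps_def Lagrange_inversion_tree_fps by (simp only:)
qed

lemma boundary_fps_0: "boundary_fps $ 0 = 1"
  by (simp add: boundary_fps_nth cycle_fps_small)

lemma boundary_fps_1: "boundary_fps $ 1 = - 1"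
  unfolding boundary_fps_nth using cycle_fps_small by (simp add: fps_mult_nth)

text \<open>The contributions to a coefficient of \<open>boundary_fps\<close> that come from the coefficients \<open>1, 1/2, 1/6, 1/4\<close> of \<open>cycle_fps\<close>: with \<open>x = p\<close> and
  \<open>a = x\<^bsup>p-2\<^esup> / (p - 2)!\<close>, each is \<open>a\<close> times a rational function of \<open>x\<close>, the first being the only
  negative one.\<close>

lemma boundary_fps_nonneg_aux:
  fixes p :: nat
  assumes p: "p \<ge> 3"
  defines "e \<equiv> \<lambda>i. ((1 - fps_X) * fps_exp (real p)) $ i"
  shows "e (p + 1) + e (p - 1) / 2 + e (p - 2) / 6 + e (p - 3) / 4 \<ge> 0"
proof -
  obtain q where q: "p = q + 3" using p by (metis add.commute le_Suc_ex)
  define x where "x = real p"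
  have x: "x \<ge> 3" using p x_def by simp
  define a where "a = x ^ (q + 1) / fact (q + 1)"
  have a: "a > 0" unfolding a_def using x by simp
  have e: "e (Suc i) = x ^ i / fact (Suc i) * (x - real (Suc i))" for i
    unfolding e_def x_def by (rule one_minus_X_mult_exp_nth)
  have qx: "real q = x - 3" using q x_def by simp
  have e1: "e (p + 1) = - (a * x / ((x - 1) * (x + 1)))"
  proof -
    have s: "p + 1 = Suc (q + 3)" "x - real (Suc (q + 3)) = - 1" using q qx by auto
    have "fact (Suc (q + 3)) = (x + 1) * x * (x - 1) * (fact (q + 1) :: real)"
      by (simp add: qx numeral_eq_Suc algebra_simps)
    moreover have "x ^ (q + 3) = x * x * x ^ (q + 1)" by (simp add: numeral_eq_Suc)
    ultimately have "x ^ (q + 3) / fact (Suc (q + 3)) = a * x / ((x - 1) * (x + 1))"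
      unfolding a_def using x by (simp add: divide_simps)
    thus ?thesis unfolding s(1) e s(2) by simp
  qed
  have e2: "e (p - 1) = a / (x - 1)"
  proof -
    have s: "p - 1 = Suc (q + 1)" "x - real (Suc (q + 1)) = 1" using q qx by auto
    have "fact (Suc (q + 1)) = (x - 1) * (fact (q + 1) :: real)"
      by (simp add: qx numeral_eq_Suc algebra_simps)
    hence "x ^ (q + 1) / fact (Suc (q + 1)) = a / (x - 1)"
      unfolding a_def using x by (simp add: divide_simps)
    thus ?thesis unfolding s(1) e s(2) by simp
  qed
  have e3: "e (p - 2) = 2 * a / x"
  proof -
    have s: "p - 2 = Suc q" "x - real (Suc q) = 2" using q qx by auto
    have "x ^ q / fact (Suc q) = a / x"
      unfolding a_def using x by (simp add: divide_simps)
    thus ?thesis unfolding s(1) e s(2) by (simp only: mult.commute times_divide_eq_right)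
  qed
  have e4: "e (p - 3) = 3 * a * (x - 2) / x\<^sup>2"
  proof (cases q)
    case 0
    hence "x = 3" "a = 3" using qx unfolding a_def by simp_all
    thus ?thesis using q 0 by (simp add: e_def)
  next
    case (Suc s)
    have s: "p - 3 = Suc s" "x - real (Suc s) = 3" using q qx Suc by auto
    have "fact (q + 1) = (x - 2) * (fact (Suc s) :: real)"
    proof -
      have "x - 2 = real (Suc (Suc s))" using qx Suc by simp
      thus ?thesis using Suc by simp
    qed
    moreover have "x ^ (q + 1) = x\<^sup>2 * x ^ s" using Suc by (simp add: power2_eq_square)
    ultimately have "x ^ s / fact (Suc s) = a * (x - 2) / x\<^sup>2"
      unfolding a_def using x by (simp add: divide_simps)
    thus ?thesis unfolding s(1) e s(2) by (simp only:) simp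
  qed
  have "e (p + 1) + e (p - 1) / 2 + e (p - 2) / 6 + e (p - 3) / 4
     = a * (1 / (2 * (x - 1)) + 1 / (3 * x) + 3 * (x - 2) / (4 * x\<^sup>2) - x / ((x - 1) * (x + 1)))"
    unfolding e1 e2 e3 e4 by (simp add: algebra_simps)
  also have "1 / (2 * (x - 1)) + 1 / (3 * x) + 3 * (x - 2) / (4 * x\<^sup>2) - x / ((x - 1) * (x + 1))
     = (7 * x ^ 3 - 12 * x\<^sup>2 - 13 * x + 18) / (12 * x\<^sup>2 * (x - 1) * (x + 1))"
    using x by (simp add: divide_simps) (simp add: algebra_simps power2_eq_square power3_eq_cube)
  also have "a * \<dots> \<ge> 0"
  proof -
    have "7 * x ^ 3 - 12 * x\<^sup>2 - 13 * x + 18 = x * (x - 3) * (7 * x + 9) + 14 * x + 18"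
      by (simp add: algebra_simps power2_eq_square power3_eq_cube)
    also have "\<dots> \<ge> 0" using x by simp
    finally show ?thesis using a x by (intro mult_nonneg_nonneg divide_nonneg_nonneg) auto
  qed
  finally show ?thesis .
qed

text \<open>By Lagrange inversion the coefficient is \<open>\<Sum>\<^sub>i K\<^sub>i e\<^bsub>k-i\<^esub>\<close> with
  \<open>e\<^sub>i = [x\<^sup>i] (1 - x) e\<^bsup>(k-1)x\<^esup>\<close>. Only \<open>e\<^sub>k\<close> is negative; the terms for \<open>i = 2, 3, 4\<close>
  (as far as they occur) outweigh it.\<close>

lemma boundary_fps_nonneg:
  assumes "k \<ge> 2"
  shows "boundary_fps $ k \<ge> 0"
proof -
  define p where "p = k - 1"
  have k: "k = Suc p" "p \<ge> 1" using assms unfolding p_def by auto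
  define e where "e = (\<lambda>i. ((1 - fps_X) * fps_exp (real p)) $ i)"
  have enn: "e i \<ge> 0" if "i \<le> p" for i
    using that one_minus_X_mult_exp_nth[of "real p"] unfolding e_def by (cases i) auto
  have g: "boundary_fps $ k = (\<Sum>i=0..k. cycle_fps $ i * e (k - i))"
    unfolding boundary_fps_nth e_def using k by (simp add: fps_mult_nth[of cycle_fps])
  have nn: "cycle_fps $ i * e (k - i) \<ge> 0" if "i \<ge> 1" for i
    using nonneg_coeffs_cycle_fps enn[of "k - i"] that k
    by (intro mult_nonneg_nonneg) (auto simp: nonneg_coeffs_def)
  have low: "(\<Sum>i\<in>J. cycle_fps $ i * e (k - i)) \<le> boundary_fps $ k" if "J \<subseteq> {0..k}" "0 \<in> J" for J
    unfolding g
  proof (rule sum_mono2)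
    fix i assume "i \<in> {0..k} - J"
    hence "i \<ge> 1" using that(2) by (cases i) auto
    thus "cycle_fps $ i * e (k - i) \<ge> 0" by (rule nn)
  qed (use that in auto)
  \<comment> \<open>for \<open>p \<le> 2\<close> the coefficient has fewer than four terms and is computed outright\<close>
  consider "p = 1" | "p = 2" | "p \<ge> 3" using k by linarith
  thus ?thesis
  proof cases
    case 1
    have "(\<Sum>i\<in>{0, 2}. cycle_fps $ i * e (k - i)) \<le> boundary_fps $ k"
      by (rule low) (use 1 k in auto)
    moreover have "e 2 = - 1/2" "e 0 = 1"
      using 1 one_minus_X_mult_exp_nth[of 1 1] unfolding e_def by (simp_all add: numeral_2_eq_2)
    ultimately show ?thesis using cycle_fps_small 1 k by (simp add: numeral_2_eq_2)
  next
    case 2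
    have "(\<Sum>i\<in>{0, 2, 3}. cycle_fps $ i * e (k - i)) \<le> boundary_fps $ k"
      by (rule low) (use 2 k in auto)
    moreover have "e 3 = - 2/3" "e 1 = 1" "e 0 = 1"
      using 2 one_minus_X_mult_exp_nth[of 2 2] one_minus_X_mult_exp_nth[of 2 0]
      unfolding e_def by (simp_all add: numeral_eq_Suc)
    ultimately show ?thesis using cycle_fps_small 2 k by simp
  next
    case 3
    have "(\<Sum>i\<in>{0, 2, 3, 4}. cycle_fps $ i * e (k - i)) \<le> boundary_fps $ k"
      by (rule low) (use 3 k in auto)
    moreover have "(\<Sum>i\<in>{0, 2, 3, 4}. cycle_fps $ i * e (k - i))
        = e (p + 1) + e (p - 1) / 2 + e (p - 2) / 6 + e (p - 3) / 4"
 using cycle_fps_small k by (simp add: mult.commute del: eq_divide_eq_numeral1)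
    ultimately show ?thesis using boundary_fps_nonneg_aux[OF 3] unfolding e_def by linarith
  qed
qed

lemma tree_fps_square_nth: "real k * (tree_fps\<^sup>2) $ k = 2 * (real k - 1) * tree_fps $ k"
proof -
  have "tree_fps\<^sup>2 = fps_const 2 * (tree_fps - unrooted_tree_fps)"
    unfolding unrooted_tree_fps_def by (simp flip: mult.assoc)
  hence sq: "(tree_fps\<^sup>2) $ k = 2 * (tree_fps $ k - unrooted_tree_fps $ k)" by simp
  have "real k * (tree_fps\<^sup>2) $ k = 2 * (real k * tree_fps $ k - real k * unrooted_tree_fps $ k)"
    unfolding sq by (simp add: algebra_simps)
  thus ?thesis unfolding unrooted_tree_fps_nth by (simp add: algebra_simps)
qed

lemma one_minus_X_mult_nth:
  "((1 - fps_X) * f) $ Suc k = f $ Suc k - (f :: real fps) $ k"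
  by (simp add: left_diff_distrib)

text \<open>\<open>T - y T = y (e\<^sup>T - T)\<close>, and \<open>e\<^sup>x - x\<close> has nonnegative coefficients.\<close>

lemma nonneg_one_minus_X_mult_tree: "nonneg_coeffs ((1 - fps_X) * tree_fps)"
proof -
  have eq: "fps_exp 1 - fps_X = 1 + fps_X\<^sup>2 * Abs_fps (\<lambda>k. 1 / fact (k + 2) :: real)"
  proof (rule fps_ext)
    fix k
    show "(fps_exp 1 - fps_X) $ k = (1 + fps_X\<^sup>2 * Abs_fps (\<lambda>k. 1 / fact (k + 2) :: real)) $ k"
      by (cases k; cases "k - 1") (auto simp: fps_X_power_mult_nth simp del: fact_Suc)
  qed
  have "(1 - fps_X) * tree_fps = fps_X * ((fps_exp 1 oo tree_fps) - tree_fps)"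
    using tree_fps_eq by (simp add: left_diff_distrib right_diff_distrib)
  also have "(fps_exp 1 oo tree_fps) - tree_fps = (fps_exp 1 - fps_X) oo tree_fps"
    by (simp add: fps_compose_sub_distrib)
  finally have "(1 - fps_X) * tree_fps = fps_X * ((fps_exp 1 - fps_X) oo tree_fps)" .
  moreover have "nonneg_coeffs (fps_exp 1 - fps_X)" unfolding eq
    by (intro nonneg_coeffs_add nonneg_coeffs_mult nonneg_coeffs_power) (simp_all add: nonneg_coeffs_def)
  ultimately show ?thesis
    by (simp add: nonneg_coeffs_mult nonneg_coeffs_compose nonneg_coeffs_tree_fps)
qed

text \<open>Unrooted trees plus half the trees with a marked edge.\<close>

definition component_fps :: "real fps" where
  "component_fps = quad_fps oo tree_fps"

lemma nonneg_coeffs_component_fps: "nonneg_coeffs component_fps"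
  unfolding component_fps_def by (rule nonneg_coeffs_quad_fps_compose_tree)

lemma component_fps_nth:
  "component_fps $ k = unrooted_tree_fps $ k + (tree_fps\<^sup>2) $ k / 4"
  unfolding component_fps_def quad_fps_compose_tree by simp

text \<open>From \<open>T = y e\<^sup>T\<close> the coefficient of \<open>T\<close> at \<open>k + 1\<close> is at least that of \<open>T + T\<^sup>2/2\<close> at \<open>k\<close>. As
  \<open>T\<^sup>2/2\<close> counts trees with a marked edge, of which a tree with at least two vertices has one, it
  dominates the unrooted trees.\<close>

lemma unrooted_tree_fps_mono:
  assumes "k \<ge> 2"
  shows "unrooted_tree_fps $ k \<le> unrooted_tree_fps $ Suc k"
proof -
  have T: "tree_fps $ i \<ge> 0" for i using nonneg_coeffs_tree_fps by (simp add: nonneg_coeffs_def)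
  have "tree_fps $ Suc k = (fps_exp 1 oo tree_fps) $ k"
    by (subst tree_fps_eq) simp
  also have "\<dots> \<ge> (\<Sum>i\<in>{1, 2}. fps_exp 1 $ i * (tree_fps ^ i) $ k)"
    unfolding fps_compose_nth
    by (rule sum_mono2) (use assms nonneg_coeffs_power[OF nonneg_coeffs_tree_fps] in \<open>auto simp: nonneg_coeffs_def\<close>)
  finally have "tree_fps $ k + (tree_fps\<^sup>2) $ k / 2 \<le> tree_fps $ Suc k" by simp
  moreover have "unrooted_tree_fps $ k \<le> (tree_fps\<^sup>2) $ k / 2"
  proof -
    have "real k * unrooted_tree_fps $ k \<le> (real k - 1) * tree_fps $ k"
      unfolding unrooted_tree_fps_nth using mult_right_mono[of 1 "real k - 1" "tree_fps $ k"] assms T[of k] by simp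
    also have "\<dots> = real k * ((tree_fps\<^sup>2) $ k / 2)"
      using tree_fps_square_nth[of k] by (simp add: field_simps)
    finally show ?thesis using assms by simp
  qed
  ultimately have "tree_fps $ k + unrooted_tree_fps $ k \<le> tree_fps $ Suc k" by linarith
  moreover have "real (Suc k) * unrooted_tree_fps $ k = tree_fps $ k + unrooted_tree_fps $ k"
    using unrooted_tree_fps_nth[of k] by (simp add: algebra_simps)
  ultimately have "real (Suc k) * unrooted_tree_fps $ k \<le> real (Suc k) * unrooted_tree_fps $ Suc k"
    unfolding unrooted_tree_fps_nth by simp
  thus ?thesis by simp
qed

lemma component_fps_mono:
  assumes "k \<ge> 2"
  shows "component_fps $ k \<le> component_fps $ Suc k"
proof -
  have "nonneg_coeffs ((1 - fps_X) * tree_fps * tree_fps)"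
    by (intro nonneg_coeffs_mult nonneg_one_minus_X_mult_tree nonneg_coeffs_tree_fps)
  hence "((1 - fps_X) * tree_fps\<^sup>2) $ Suc k \<ge> 0"
    unfolding nonneg_coeffs_def power2_eq_square mult.assoc by blast
  thus ?thesis unfolding component_fps_nth one_minus_X_mult_nth
    using unrooted_tree_fps_mono[OF assms] by simp
qed

lemma component_fps_small: "component_fps $ 0 = 0" "component_fps $ 1 = 1" "component_fps $ 2 = 3/4"
proof -
  have T2: "(tree_fps\<^sup>2) $ 2 = 1" "(tree_fps\<^sup>2) $ 1 = 0" "(tree_fps\<^sup>2) $ 0 = 0"
    by (simp_all add: power2_eq_square fps_mult_nth numeral_2_eq_2)
  show "component_fps $ 0 = 0"
    using T2 by (simp add: component_fps_nth unrooted_tree_fps_def)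
  show "component_fps $ 1 = 1"
    using T2 unrooted_tree_fps_nth[of 1] by (simp add: component_fps_nth)
  show "component_fps $ 2 = 3/4"
    using T2 unrooted_tree_fps_nth[of 2] tree_fps_square_nth[of 2] by (simp add: component_fps_nth)
qed

text \<open>The coefficients \<open>0, 1, 3/4, 1, \<dots>\<close> do not decrease from index \<open>2\<close> on.\<close>

lemma one_minus_X_mult_component:
  obtains W where "nonneg_coeffs W" "(1 - fps_X) * component_fps = fps_X - fps_const (1/4) * fps_X\<^sup>2 + W"
proof -
  define W where "W = (1 - fps_X) * component_fps - fps_X + fps_const (1/4) * fps_X\<^sup>2"
  have "W $ k \<ge> 0" for k
  proof -
    consider "k = 0" | "k = 1" | "k = 2" | j where "k = Suc j" "j \<ge> 2"
      by (metis One_nat_def Suc_1 not_less_eq_eq old.nat.exhaust le_0_eq le_SucE le_zero_eq)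
    thus ?thesis
    proof cases
      case 4
      have "W $ k = component_fps $ Suc j - component_fps $ j"
        unfolding W_def 4(1) using 4(2) one_minus_X_mult_nth[of component_fps j] by (simp add: fps_X_power_iff)
      thus ?thesis using component_fps_mono[OF 4(2)] by simp
    qed (use component_fps_small one_minus_X_mult_nth[of component_fps 0] one_minus_X_mult_nth[of component_fps 1]
        in \<open>auto simp: W_def fps_X_power_iff numeral_2_eq_2\<close>)
  qed
  thus ?thesis using that[of W] unfolding W_def nonneg_coeffs_def by simp
qed

text \<open>The single negative term \<open>- y\<^sup>2/4\<close> of \<open>(1 - y) S\<close> is compensated in \<open>S\<close> times this series, because
  \<open>S (1 - y/4) = (1 - y) S + 3/4 y S\<close> and \<open>S\<close> starts with \<open>y\<close>.\<close>

lemma nonneg_component_square_one_minus_X: "nonneg_coeffs (component_fps\<^sup>2 * (1 - fps_X))"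
proof -
  obtain W where W: "nonneg_coeffs W" "(1 - fps_X) * component_fps = fps_X - fps_const (1/4) * fps_X\<^sup>2 + W"
    by (rule one_minus_X_mult_component)
  \<comment> \<open>\<open>component_fps\<close> starts with \<open>y\<close>, so even \<open>3/4\<close> of it exceeds \<open>y/4\<close>\<close>
  define R where "R = fps_const (3/4) * component_fps - fps_const (1/4) * fps_X"
  have R: "nonneg_coeffs R"
    using nonneg_coeffs_component_fps component_fps_small(2) unfolding nonneg_coeffs_def R_def fps_X_def by auto
  have c: "fps_const (3/4) = 1 - fps_const (1/4 :: real)" by simp
  have "component_fps\<^sup>2 * (1 - fps_X) = component_fps * ((1 - fps_X) * component_fps)"
    by (simp only: power2_eq_square ac_simps)
  also have "\<dots> = fps_X * ((1 - fps_X) * component_fps + fps_X * (fps_const (3/4) * component_fps)) + component_fps * W"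
    unfolding c by (subst (1) W(2)) (simp add: power2_eq_square algebra_simps del: fps_const_sub)
  also have "\<dots> = fps_X * (fps_X + fps_X * R + W) + component_fps * W"
    unfolding W(2) R_def by (simp add: power2_eq_square algebra_simps)
  finally show ?thesis
    using W R nonneg_coeffs_component_fps by (simp add: nonneg_coeffs_add nonneg_coeffs_mult)
qed

text \<open>Write \<open>boundary_fps = (1 - y) + E\<close> with \<open>E\<close> nonnegative. The product of \<open>1 - y\<close> with the \<open>j\<close>-th power of
  \<open>component_fps\<close> is nonnegative for \<open>j \<ge> 2\<close>, and from \<open>y\<^sup>3\<close> on for \<open>j \<le> 1\<close>. For \<open>m = 2\<close> and \<open>j = 1\<close>
  the conclusion fails.\<close>

lemma boundary_case_nonneg:
  assumes "m = Suc n" "m \<ge> 3"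
  shows "(quad_fps ^ j * base_fps n) $ m \<ge> 0"
proof -
  have nm: "real n - real m = - 1" using assms by simp
  have eq: "(quad_fps ^ j * base_fps n) $ m = (component_fps ^ j * boundary_fps) $ m"
    unfolding base_fps_Lagrange nm component_fps_def boundary_fps_def ..
  define E where "E = boundary_fps - (1 - fps_X)"
  have E: "nonneg_coeffs E"
    unfolding nonneg_coeffs_def
  proof
    fix k show "E $ k \<ge> 0"
    proof (cases "k \<ge> 2")
      case True
      thus ?thesis using boundary_fps_nonneg[OF True] by (simp add: E_def fps_X_def)
    next
      case False
      hence "k = 0 \<or> k = 1" by linarith
      thus ?thesis using boundary_fps_0 boundary_fps_1 by (auto simp: E_def)
    qed
  qed
  have b: "boundary_fps = (1 - fps_X) + E" by (simp add: E_def)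
  consider "j = 0" | "j = 1" | i where "j = i + 2" by (metis add.commute add_2_eq_Suc not0_implies_Suc One_nat_def)
  thus ?thesis
  proof cases
    case 1
    thus ?thesis using eq boundary_fps_nonneg[of m] assms by simp
  next
    case 2
    obtain W where W: "nonneg_coeffs W" "(1 - fps_X) * component_fps = fps_X - fps_const (1/4) * fps_X\<^sup>2 + W"
      by (rule one_minus_X_mult_component)
    have "component_fps ^ j * boundary_fps = fps_X - fps_const (1/4) * fps_X\<^sup>2 + (W + component_fps * E)"
      using 2 W(2) unfolding b by (simp add: algebra_simps)
    moreover have "nonneg_coeffs (W + component_fps * E)"
      using W E nonneg_coeffs_component_fps by (simp add: nonneg_coeffs_add nonneg_coeffs_mult)
    ultimately show ?thesis using assms unfolding eq nonneg_coeffs_def by (simp add: fps_X_power_iff)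
  next
    case 3
    have "component_fps ^ j * boundary_fps = component_fps ^ i * (component_fps\<^sup>2 * (1 - fps_X)) + component_fps ^ j * E"
      unfolding b 3 by (simp add: power_add power2_eq_square distrib_left mult.assoc)
    moreover have "nonneg_coeffs \<dots>"
      by (intro nonneg_coeffs_add nonneg_coeffs_mult nonneg_coeffs_power nonneg_coeffs_component_fps
          nonneg_component_square_one_minus_X E)
    ultimately show ?thesis unfolding eq nonneg_coeffs_def by simp
  qed
qed

section \<open>The Ehrhart polynomial\<close>

text \<open>In closed form \<open>exp (r (x - x\<^sup>2/4) + (n - 1/2) x + x\<^sup>2/4) \<surd>(1 - x)\<close>.\<close>

definition count_fps :: "nat \<Rightarrow> real \<Rightarrow> real fps" where
  "count_fps n r = (fps_exp r oo quad_fps) * base_fps n"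

lemma geometric_fps: "f = (1 - fps_X) * g \<Longrightarrow> g $ k = (\<Sum>i\<le>k. f $ i)" for f g :: "real fps"
  by (induction k) (simp_all add: one_minus_X_mult_nth del: fps_mult_fps_X_commute)

text \<open>The factor \<open>1 - x\<close> is split off because the logarithmic derivative has a pole at \<open>1\<close>: in terms of
  \<open>B = count_fps / (1 - x)\<close> the differential equation has polynomial coefficients.\<close>

lemma count_fps_deriv:
  defines "B \<equiv> \<lambda>n r. (fps_exp r oo quad_fps) * (fps_exp (real n) * cycle_fps)"
  shows "count_fps n r = (1 - fps_X) * B n r"
    and "fps_deriv (count_fps n r) = fps_const (r + real n - 1) * count_fps n r
      - fps_const (r / 2) * (fps_X * count_fps n r) - fps_const (1/2) * (fps_X * (fps_X * B n r))"
proof -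
  show eq: "count_fps n r = (1 - fps_X) * B n r"
    unfolding count_fps_def base_fps_def B_def by (simp only: ac_simps)
  define q where "q = fps_const r * (1 - fps_const (1/2) * fps_X)"
  have "fps_deriv quad_fps = 1 - fps_const (1/2) * fps_X"
  proof -
    have "fps_const (1/4) * (f + f) = fps_const (1/2) * f" for f :: "real fps"
      by (rule fps_ext) simp
    thus ?thesis unfolding quad_fps_def power2_eq_square by simp
  qed
  hence "fps_deriv (fps_exp r oo quad_fps) = (fps_exp r oo quad_fps) * q"
    by (simp add: fps_compose_deriv quad_fps_def q_def fps_compose_mult_distrib)
  hence dB: "fps_deriv (B n r) = B n r * (q + fps_const (real n) + cycle_rate_fps)"
    unfolding B_def by (simp add: cycle_fps_deriv algebra_simps)
  have "fps_deriv (count_fps n r) = (1 - fps_X) * B n r * (q + fps_const (real n))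
      + B n r * ((1 - fps_X) * cycle_rate_fps) - B n r"
    unfolding eq by (simp add: dB algebra_simps)
  also have "\<dots> = count_fps n r * (q + fps_const (real n) - 1) - fps_const (1/2) * (fps_X * (fps_X * B n r))"
    unfolding one_minus_X_mult_cycle_rate eq by (simp add: algebra_simps power2_eq_square)
  also have "q + fps_const (real n) - 1 = fps_const (r + real n - 1) - fps_const (r / 2) * fps_X"
    unfolding q_def by (rule fps_ext) (simp add: fps_X_def algebra_simps)
  finally show "fps_deriv (count_fps n r) = fps_const (r + real n - 1) * count_fps n r
      - fps_const (r / 2) * (fps_X * count_fps n r) - fps_const (1/2) * (fps_X * (fps_X * B n r))"
    by (simp add: algebra_simps)
qed

lemma count_fps_0: "count_fps n r $ 0 = 1"
  by (simp add: count_fps_def base_fps_def cycle_fps_small)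

lemma count_fps_Suc:
  "real (Suc k) * count_fps n r $ Suc k = (r + real n - 1) * count_fps n r $ k
     - (if k = 0 then 0 else r / 2 * count_fps n r $ (k - 1)) - (\<Sum>i<k - 1. count_fps n r $ i) / 2"
proof -
  define B where "B = (fps_exp r oo quad_fps) * (fps_exp (real n) * cycle_fps)"
  note d = count_fps_deriv[of n r, folded B_def]
  have "(fps_X * (fps_X * B)) $ k = (\<Sum>i<k - 1. count_fps n r $ i)"
    using geometric_fps[OF d(1)] by (cases k; cases "k - 1") (auto simp: lessThan_Suc_atMost)
  thus ?thesis using arg_cong[OF d(2), of "\<lambda>f. f $ k"] by simp
qed

text \<open>The differential equation of \<open>count_fps\<close> for \<open>r = 1 + 1/t\<close> is the counting recursion: after division by
  \<open>k! t\<^sup>k\<close>, the auxiliary numbers \<open>Z\<close> become partial sums of the coefficients.\<close>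

lemma card_bounded_vectors_eq_coeff:
  fixes U :: "'a set"
  assumes t: "t > 0" and U: "finite U" "card U \<le> Suc n"
  shows "real (card (bounded_vectors t (n * t) U))
    = fact (card U) * real t ^ card U * count_fps n (1 + 1 / real t) $ card U"
proof -
  define F where "F = (\<lambda>k. count_fps n (1 + 1 / real t) $ k)"
  define N where "N = (\<lambda>k. fact k * real t ^ k * F k)"
  define Z where "Z = (\<lambda>k. fact (k - 2) * real t ^ (k - 1) * (\<Sum>i<k - 1. F i))"
  have N_Suc: "N (Suc k) = fact k * real t ^ k * ((1 + real n * real t) * F k
     - (if k = 0 then 0 else (real t + 1) / 2 * F (k - 1)) - real t / 2 * (\<Sum>i<k - 1. F i))" for k
  proof -
    have "N (Suc k) = fact k * real t ^ k * (real t * (real (Suc k) * F (Suc k)))"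
      unfolding N_def by (simp add: algebra_simps)
    also have "real (Suc k) * F (Suc k) = (1 / real t + real n) * F k
       - (if k = 0 then 0 else (1 + 1 / real t) / 2 * F (k - 1)) - (\<Sum>i<k - 1. F i) / 2"
      using count_fps_Suc[of k n "1 + 1 / real t"] unfolding F_def by simp
    also have "real t * \<dots> = (1 + real n * real t) * F k
       - (if k = 0 then 0 else (real t + 1) / 2 * F (k - 1)) - real t / 2 * (\<Sum>i<k - 1. F i)"
      using t by (cases k) (simp_all add: field_simps del: sum.lessThan_Suc)
    finally show ?thesis .
  qed
  have "real (card (bounded_vectors t (n * t) U)) = N (card U)"
  proof (rule card_bounded_vectors_and_total_excess(1)[where Z = Z])
    show "N 0 = 1" unfolding N_def F_def by (simp add: count_fps_0)
    have "card U - 1 \<le> n" using U by linarith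
    thus "t * (card U - 1) \<le> n * t" by (simp add: mult.commute)
    show "Z (Suc (Suc r)) = real t * (N r + real r * Z (Suc r))" for r
      by (cases r) (simp_all add: Z_def N_def algebra_simps)
    fix r
    consider "r = 0" | "r = 1" | s where "r = Suc (Suc s)" by (metis One_nat_def not0_implies_Suc)
    thus "N (Suc r) = (1 + real (n * t)) * N r
       - (real r * real t * (real t + 1) * N (r - 1) + real r * (real r - 1) * (real t)\<^sup>2 * Z r) / 2"
    proof cases
      case 1
      show ?thesis unfolding N_Suc[of r] unfolding 1 by (simp add: N_def)
    next
      case 2
      show ?thesis unfolding N_Suc[of r] unfolding 2
        by (simp add: N_def Z_def field_simps)
    next
      case 3
      show ?thesis unfolding N_Suc[of r] unfolding 3 N_def Z_def
        by (simp add: field_simps power2_eq_square del: sum.lessThan_Suc)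
    qed
  qed (use U in auto)
  thus ?thesis unfolding N_def F_def .
qed

lemma quad_fps_power_nth_less: "i < j \<Longrightarrow> (quad_fps ^ j) $ i = 0"
  by (rule startsby_zero_power_prefix[rule_format]) (simp_all add: quad_fps_def)

text \<open>Terms with \<open>j > m\<close> drop out because \<open>quad_fps\<close> starts with \<open>x\<close>.\<close>

lemma count_fps_expand:
  "count_fps n r $ m = (\<Sum>j\<le>m. r ^ j / fact j * (quad_fps ^ j * base_fps n) $ m)"
proof -
  have "(fps_exp r oo quad_fps) $ i = (\<Sum>j\<le>m. r ^ j / fact j * (quad_fps ^ j) $ i)" if "i \<le> m" for i
    unfolding fps_compose_nth atLeast0AtMost
    by (rule sum.mono_neutral_cong_left) (use that quad_fps_power_nth_less in auto)
  hence "count_fps n r $ m = (\<Sum>i\<le>m. (\<Sum>j\<le>m. r ^ j / fact j * (quad_fps ^ j) $ i) * base_fps n $ (m - i))"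
    unfolding count_fps_def fps_mult_nth atLeast0AtMost by (intro sum.cong) auto
  also have "\<dots> = (\<Sum>j\<le>m. r ^ j / fact j * (\<Sum>i\<le>m. (quad_fps ^ j) $ i * base_fps n $ (m - i)))"
    unfolding sum_distrib_right sum_distrib_left by (subst sum.swap) (simp add: mult.assoc)
  finally show ?thesis unfolding fps_mult_nth[of _ "base_fps n"] atLeast0AtMost .
qed

text \<open>The coefficient of \<open>t\<^sup>j (1 + t)\<^bsup>m-j\<^esup>\<close> in the Ehrhart polynomial.\<close>

definition magic_coeff :: "nat \<Rightarrow> nat \<Rightarrow> nat \<Rightarrow> real" where
  "magic_coeff m n j = fact m / fact (m - j) * (quad_fps ^ (m - j) * base_fps n) $ m"

lemma lattice_point_count_magic:
  assumes n: "CARD('m::finite) \<le> Suc n" and t: "t > 0"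
  shows "real (lattice_point_count (partial_permutohedron n :: (real ^ 'm) set) t)
    = (\<Sum>j\<le>CARD('m). magic_coeff CARD('m) n j * (real t ^ j * (1 + real t) ^ (CARD('m) - j)))"
proof -
  let ?m = "CARD('m)"
  have "real (lattice_point_count (partial_permutohedron n :: (real ^ 'm) set) t)
    = fact ?m * real t ^ ?m * count_fps n (1 + 1 / real t) $ ?m"
    unfolding lattice_point_count_partial_permutohedron[OF n t]
    using card_bounded_vectors_eq_coeff[OF t finite[of UNIV] n] by simp
  also have "\<dots> = (\<Sum>j\<le>?m. fact ?m * real t ^ ?m *
      ((1 + 1 / real t) ^ j / fact j * (quad_fps ^ j * base_fps n) $ ?m))"
    unfolding count_fps_expand sum_distrib_left ..
  also have "\<dots> = (\<Sum>j\<le>?m. fact ?m * real t ^ ?m *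
      ((1 + 1 / real t) ^ (?m - j) / fact (?m - j) * (quad_fps ^ (?m - j) * base_fps n) $ ?m))"
    by (rule sum.reindex_bij_witness[of _ "\<lambda>j. ?m - j" "\<lambda>j. ?m - j"]) auto
  also have "\<dots> = (\<Sum>j\<le>?m. magic_coeff ?m n j * (real t ^ j * (1 + real t) ^ (?m - j)))"
  proof (rule sum.cong[OF refl])
    fix j assume "j \<in> {..?m}"
    hence "real t ^ ?m = real t ^ j * real t ^ (?m - j)" by (simp flip: power_add)
    hence "real t ^ ?m * (1 + 1 / real t) ^ (?m - j) = real t ^ j * (real t * (1 + 1 / real t)) ^ (?m - j)"
      by (simp only: power_mult_distrib mult.assoc)
    also have "real t * (1 + 1 / real t) = 1 + real t" using t by (simp add: field_simps)
    finally have power: "real t ^ ?m * (1 + 1 / real t) ^ (?m - j) = real t ^ j * (1 + real t) ^ (?m - j)" .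
    show "fact ?m * real t ^ ?m *
      ((1 + 1 / real t) ^ (?m - j) / fact (?m - j) * (quad_fps ^ (?m - j) * base_fps n) $ ?m)
      = magic_coeff ?m n j * (real t ^ j * (1 + real t) ^ (?m - j))"
      unfolding magic_coeff_def power[symmetric] by simp
  qed
  finally show ?thesis .
qed

lemma magic_coeff_0: "magic_coeff m n 0 = 1"
proof -
  have factor: "quad_fps = fps_X * (1 - fps_const (1/4) * fps_X)"
    by (simp add: quad_fps_def power2_eq_square algebra_simps)
  have shift: "quad_fps ^ m * base_fps n = fps_X ^ m * ((1 - fps_const (1/4) * fps_X) ^ m * base_fps n)"
    unfolding factor by (simp only: power_mult_distrib mult.assoc)
  have "((1 - fps_const (1/4) * fps_X) ^ m * base_fps n) $ 0 = 1"
    by (simp add: base_fps_def cycle_fps_small fps_power_zeroth)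
  hence "(quad_fps ^ m * base_fps n) $ m = 1"
    unfolding shift fps_X_power_mult_nth by simp
  thus ?thesis by (simp add: magic_coeff_def)
qed

section \<open>Real-rootedness for partial permutohedra\<close>

theorem corollary1p4:
  fixes m n :: nat
  assumes "m = CARD('m::finite)"
    and "n \<ge> 1"
    and "n \<ge> m - 1"
  shows "real_rooted (h_star_poly (partial_permutohedron n :: (real ^ 'm) set))"
proof -
  let ?P = "partial_permutohedron n :: (real ^ 'm) set"
  have n: "CARD('m) \<le> Suc n" using assms by simp
  have h: "h_star_poly ?P = (\<Sum>j\<le>m. smult (magic_coeff m n j) (eulerian_refinement m j))"
    unfolding assms(1)
    by (rule h_star_poly_magic[OF aff_dim_partial_permutohedron[OF assms(2)]])
      (use lattice_point_count_magic[OF n] magic_coeff_0 in auto)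
  show ?thesis
  proof (cases "m = 2 \<and> n = 1")
    \<comment> \<open>the unit triangle: the coefficients are \<open>1, - 1/2, 0\<close>, and the combination of refined Eulerian polynomials is constant\<close>
    case True
    have b: "base_fps 1 $ 0 = 1" "base_fps 1 $ 1 = 0" "base_fps 1 $ 2 = 0"
      by (simp_all add: base_fps_def fps_mult_nth numeral_2_eq_2 left_diff_distrib
          cycle_fps_small(1) cycle_fps_small(2)[unfolded One_nat_def] cycle_fps_small(3)[unfolded numeral_2_eq_2])
    have q: "quad_fps $ 0 = 0" "quad_fps $ 1 = 1" "quad_fps $ 2 = - 1/4"
      by (simp_all add: quad_fps_def fps_X_power_iff)
    have "magic_coeff 2 1 2 = 0" "magic_coeff 2 1 1 = - 1/2" "magic_coeff 2 1 0 = 1"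
      using b q magic_coeff_0 by (simp_all add: magic_coeff_def fps_mult_nth numeral_2_eq_2)
    hence "h_star_poly ?P = 1"
      unfolding h using True by (simp add: numeral_2_eq_2) (simp add: numeral_poly one_pCons)
    thus ?thesis by (simp add: real_rooted_def)
  next
    case False
    have "magic_coeff m n j \<ge> 0" for j
    proof (cases "m \<le> n")
      case True
      thus ?thesis unfolding magic_coeff_def using base_fps_nonneg by simp
    next
      case False
      hence "m = Suc n" "m \<ge> 3" using assms(2,3) \<open>\<not> (m = 2 \<and> n = 1)\<close> by auto
      thus ?thesis unfolding magic_coeff_def using boundary_case_nonneg by simp
    qed
    thus ?thesis unfolding h
      by (intro real_rooted_eulerian_combination) (auto simp: magic_coeff_0 intro!: exI[of _ 0])
  qed
qed

end
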